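(* Let $r\ge 3$, $s,t\ge 2$, and $a,b$ be integers with $a+b=r$ and $b<a<r$. Let $T$ be a tree with bipartition $(U,V)$, $|U|=s$, $|V|=t$, and let $\mathcal T=T(a,b)$ be its $(a,b)$-blowup. Then, as $n\to\infty$, every $\mathcal T$-free $r$-graph $H$ on $n$ vertices satisfies \[|H|\le (t-1)\binom{n}{r-1}+o(n^{r-1}).\] Moreover, if $t\le s$, this bound is asymptotically sharp, i.e. ${\rm ex}_r(n,\mathcal T)=(t-1)\binom{n}{r-1}+o(n^{r-1})$.
   Context: An $r$-graph is a family of $r$-element subsets of a finite vertex set; $H$ is $\mathcal T$-free if it contains no copy of $\mathcal T$, and ${\rm ex}_r(n,\mathcal T)$ is the maximum number of edges of a $\mathcal T$-free $r$-graph on $n$ vertices. For a bipartite graph $T$ with parts $U=\{u_1,\dots,u_s\}$ and $V=\{v_1,\dots,v_t\}$ and positive integers $a,b$, the $(a,b)$-blowup $T(a,b)$ is the $(a+b)$-graph obtained by taking pairwise disjoint sets $U_1,\dots,U_s,V_1,\dots,V_t$ with $|U_i|=a$, $|V_j|=b$, and letting the edge set be $\{U_i\cup V_j: u_iv_j\in E(T)\}$. *)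

theory Defs
  imports Complex_Main "HOL-Library.Landau_Symbols"
begin

definition r_graph :: "nat \<Rightarrow> 'a set \<Rightarrow> 'a set set \<Rightarrow> bool" where
  "r_graph r X H \<longleftrightarrow> finite X \<and> (\<forall>e\<in>H. e \<subseteq> X \<and> card e = r)"

(* Hypergraphs are identified with their edge families, so the vertices of the
   pattern F are the points covered by its edges. Copies need not be induced. *)
definition contains_copy :: "'a set set \<Rightarrow> 'b set set \<Rightarrow> bool" where
  "contains_copy H F \<longleftrightarrow> (\<exists>\<phi>. inj_on \<phi> (\<Union>F) \<and> (\<forall>e\<in>F. \<phi> ` e \<in> H))"

abbreviation free_of :: "'a set set \<Rightarrow> 'b set set \<Rightarrow> bool" where
  "free_of H F \<equiv> \<not> contains_copy H F"

(* The set is always finite; it is nonempty whenever F is, because the edgeless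
   hypergraph is then F-free. *)
definition turan_number :: "nat \<Rightarrow> nat \<Rightarrow> 'b set set \<Rightarrow> nat" where
  "turan_number r n F =
     Max {card H | H. r_graph r {..<n} H \<and> free_of H F}"

definition connected_graph :: "'a set \<Rightarrow> 'a set set \<Rightarrow> bool" where
  "connected_graph W E \<longleftrightarrow>
     W \<noteq> {} \<and> (\<forall>x\<in>W. \<forall>y\<in>W. (x, y) \<in> {(p, q). {p, q} \<in> E}\<^sup>*)"

definition graph_cycle :: "'a set set \<Rightarrow> 'a list \<Rightarrow> bool" where
  "graph_cycle E xs \<longleftrightarrow> length xs \<ge> 3 \<and> distinct xs \<and>
     (\<forall>i<length xs. {xs ! i, xs ! (Suc i mod length xs)} \<in> E)"

definition tree_graph :: "'a set \<Rightarrow> 'a set set \<Rightarrow> bool" where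
  "tree_graph W E \<longleftrightarrow>
     r_graph 2 W E \<and> connected_graph W E \<and> (\<nexists>xs. graph_cycle E xs)"

definition bipartition :: "'a set \<Rightarrow> 'a set set \<Rightarrow> 'a set \<Rightarrow> 'a set \<Rightarrow> bool" where
  "bipartition W E U V \<longleftrightarrow> U \<union> V = W \<and> U \<inter> V = {} \<and>
     (\<forall>e\<in>E. \<exists>u\<in>U. \<exists>v\<in>V. e = {u, v})"

(* Canonical pairwise disjoint blocks: a vertex u of U becomes {u} \<times> {..<a},
   a vertex v of V becomes {v} \<times> {..<b}. *)
definition blowup :: "nat \<Rightarrow> nat \<Rightarrow> 'a set \<Rightarrow> 'a set \<Rightarrow> 'a set set \<Rightarrow> ('a \<times> nat) set set" where
  "blowup a b U V E =
     {({u} \<times> {..<a}) \<union> ({v} \<times> {..<b}) | u v. u \<in> U \<and> v \<in> V \<and> {u, v} \<in> E}"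

end

theory Submission
  imports Defs "HOL-Library.Disjoint_Sets" "HOL-Library.Transitive_Closure_Table"
begin

text \<open>Start from all pairs \<open>(e, c)\<close> of an edge \<open>e\<close> of \<open>H\<close> and a vertex \<open>c \<in> e\<close>, its centre, and repeatedly
  delete (i) the pairs with \<open>e - {c} = P\<close> when fewer than \<open>t\<close> of them are left, (ii) the pairs with
  centre \<open>c\<close> and \<open>S \<subseteq> e\<close>, for \<open>c \<in> S\<close> of size \<open>b\<close> or \<open>a + 1\<close>, when the sets \<open>e - S\<close> are covered by boundedly
  many vertices, and (iii) the pairs with \<open>A \<subseteq> e - {c}\<close> when there are fewer than \<open>\<delta> n^(b-1)\<close> of them.

  If something survives, the blowup is found by adding the blocks of \<open>U\<close> one at a time, each together
  with its new neighbours. The only obstruction is that too many of the available centres already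
  belong to the part embedded so far; then a set of centres that is common to many blocks \<open>A\<close> has
  grown, and after at most \<open>t\<close> repetitions \<open>t\<close> centres share many blocks and the blowup is complete.

  If nothing survives, an edge \<open>e\<close> either loses some pair by (i), which happens to at most
  \<open>(t - 1) (n choose (r - 1))\<close> edges, or by (iii), or it loses all its pairs by (ii). In the last case, and
  because the splits \<open>e = A \<union> B\<close> in which both parts extend freely are eliminated in the same way, \<open>e\<close>
  is determined up to boundedly many choices by some \<open>r - 2\<close> of its vertices.

  For the lower bound take all \<open>r\<close>-sets that meet a fixed set of \<open>t - 1\<close> vertices exactly once.\<close>

text \<open>A pair deleted by (i) charges its edge to the (r-1)-set \<open>P = e - {c}\<close>. A
  deleted group is emptied for good, so each \<open>P\<close> is charged at most
  \<open>t - 1\<close> edges; this is the whole leading term. One such pair per edge is enough,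
  whereas (ii) has to be exploited for all \<open>r\<close> centres of an edge at once. The two
  sizes in (ii) reflect two kinds of freedom: \<open>S\<close> of size \<open>b\<close> is a
  finished block of \<open>V\<close> to which more blocks of \<open>U\<close> get attached;
  \<open>S\<close> of size \<open>a + 1\<close> is a block of \<open>U\<close> with a centre, to be
  filled up to a block of \<open>V\<close>. But (i) promises only \<open>t\<close> centres, a number
  that does not grow with \<open>n\<close>, so nothing keeps centres away from vertices already in
  use. Rule (iii) makes this failure useful: since few centres are available, a positive fraction of
  the sets completing \<open>A\<close> share the same used centres, more than
  \<open>card (NZ k)\<close> of them. Among many blocks \<open>A\<close> some \<open>k + 1\<close>
  then have a common family of completing sets that still has positive density, so the copy can be
  rebuilt from scratch, with the shared centres hosting all earlier vertices of
  \<open>V\<close>.\<close>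

text \<open>Removing the whole group of a key makes the key inert from then on, so each key fires at
  most once and a single set \<open>R \<kappa>\<close> records what it removed. Losses can therefore
  be counted key by key.\<close>

lemma elimination:
  fixes \<Gamma> :: "'k \<Rightarrow> 'a set" and Good :: "'k \<Rightarrow> 'a set \<Rightarrow> bool"
  assumes "finite K"
  shows "\<exists>K' R. K' \<subseteq> K \<and> (\<forall>\<kappa>. K' \<inter> \<Gamma> \<kappa> = {} \<or> Good \<kappa> (K' \<inter> \<Gamma> \<kappa>)) \<and>
    (\<forall>\<kappa>. R \<kappa> \<subseteq> K \<inter> \<Gamma> \<kappa> \<and> (R \<kappa> = {} \<or> \<not> Good \<kappa> (R \<kappa>))) \<and> K = K' \<union> (\<Union>\<kappa>. R \<kappa>)"
  using assms
proof (induction K rule: finite_psubset_induct)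
  case (psubset K)
  show ?case
  proof (cases "\<forall>\<kappa>. K \<inter> \<Gamma> \<kappa> = {} \<or> Good \<kappa> (K \<inter> \<Gamma> \<kappa>)")
    case True
    then show ?thesis by (intro exI[of _ K] exI[of _ "\<lambda>_. {}"]) auto
  next
    case False
    then obtain \<kappa>0 where ne: "K \<inter> \<Gamma> \<kappa>0 \<noteq> {}" and bad: "\<not> Good \<kappa>0 (K \<inter> \<Gamma> \<kappa>0)" by auto
    let ?L = "K - \<Gamma> \<kappa>0"
    have "?L \<subset> K" using ne by auto
    from psubset.IH[OF this] obtain K' R where IH: "K' \<subseteq> ?L"
      "\<forall>\<kappa>. K' \<inter> \<Gamma> \<kappa> = {} \<or> Good \<kappa> (K' \<inter> \<Gamma> \<kappa>)"
      "\<forall>\<kappa>. R \<kappa> \<subseteq> ?L \<inter> \<Gamma> \<kappa> \<and> (R \<kappa> = {} \<or> \<not> Good \<kappa> (R \<kappa>))" "?L = K' \<union> (\<Union>\<kappa>. R \<kappa>)"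
      by metis
    let ?R = "R(\<kappa>0 := K \<inter> \<Gamma> \<kappa>0)"
    \<comment> \<open>The recursive call started from a set disjoint from
      \<open>\<Gamma> \<kappa>0\<close>, so overwriting this value loses nothing.\<close>
    have R0: "R \<kappa>0 = {}" using IH(3) by blast
    have "(\<Union>\<kappa>. ?R \<kappa>) = (\<Union>\<kappa>. R \<kappa>) \<union> (K \<inter> \<Gamma> \<kappa>0)"
      using R0 by (auto split: if_splits)
    moreover have "K = ?L \<union> (K \<inter> \<Gamma> \<kappa>0)" by auto
    ultimately have "K = K' \<union> (\<Union>\<kappa>. ?R \<kappa>)" using IH(4) by (simp add: Un_assoc)
    moreover have "\<forall>\<kappa>. ?R \<kappa> \<subseteq> K \<inter> \<Gamma> \<kappa> \<and> (?R \<kappa> = {} \<or> \<not> Good \<kappa> (?R \<kappa>))"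
      using IH(3) bad by (auto simp: subset_iff)
    ultimately show ?thesis using IH(1,2) by (intro exI[of _ K'] exI[of _ ?R]) auto
  qed
qed

section \<open>Families without small transversals\<close>

text \<open>In hypergraph terms, the transversal number of \<open>\<A>\<close> exceeds
  \<open>L\<close>. A family containing the empty set is spread for every \<open>L\<close>, which
  takes care of \<open>b = 1\<close> later.\<close>

definition spread :: "nat \<Rightarrow> 'x set set \<Rightarrow> bool" where
  "spread L \<A> \<longleftrightarrow> (\<forall>Y. finite Y \<and> card Y \<le> L \<longrightarrow> (\<exists>A\<in>\<A>. A \<inter> Y = {}))"

lemma spreadD:
  assumes "spread L \<A>" "finite Y" "card Y \<le> L"
  obtains A where "A \<in> \<A>" "A \<inter> Y = {}"
  using assms by (auto simp: spread_def)

lemma not_spreadE: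
  assumes "\<not> spread L \<A>"
  obtains Y where "finite Y" "card Y \<le> L" "\<And>A. A \<in> \<A> \<Longrightarrow> A \<inter> Y \<noteq> {}"
  using assms by (auto simp: spread_def)

lemma spread_antimono: "spread L \<A> \<Longrightarrow> M \<le> L \<Longrightarrow> \<A> \<subseteq> \<B> \<Longrightarrow> spread M \<B>"
  unfolding spread_def by (meson order_trans subsetD)

text \<open>If every colour class had a transversal of size at most \<open>M\<close>, their union
  with \<open>Y0\<close> would be a transversal of size at most \<open>L\<close>.\<close>

lemma spread_pigeonhole:
  assumes sp: "spread L \<A>" and "finite I" "finite Y0" and L: "card Y0 + card I * M \<le> L"
    and col: "\<And>A. A \<in> \<A> \<Longrightarrow> A \<inter> Y0 = {} \<Longrightarrow> \<exists>i\<in>I. Q i A"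
  shows "\<exists>i\<in>I. spread M {A\<in>\<A>. Q i A}"
proof (rule ccontr)
  assume "\<not> ?thesis"
  then have ns: "\<not> spread M {A\<in>\<A>. Q i A}" if "i \<in> I" for i using that by simp
  have "\<exists>Y. finite Y \<and> card Y \<le> M \<and> (\<forall>A\<in>\<A>. Q i A \<longrightarrow> A \<inter> Y \<noteq> {})" if "i \<in> I" for i
    by (rule not_spreadE[OF ns[OF that]]) auto
  then obtain Y where Y: "\<And>i. i \<in> I \<Longrightarrow> finite (Y i) \<and> card (Y i) \<le> M \<and> (\<forall>A\<in>\<A>. Q i A \<longrightarrow> A \<inter> Y i \<noteq> {})"
    by metis
  let ?Y = "Y0 \<union> (\<Union>i\<in>I. Y i)"
  have "card (\<Union>i\<in>I. Y i) \<le> (\<Sum>i\<in>I. card (Y i))" by (rule card_UN_le[OF \<open>finite I\<close>])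
  also have "\<dots> \<le> card I * M" using Y sum_bounded_above[of I "\<lambda>i. card (Y i)" M] by auto
  finally have "card ?Y \<le> L" using L card_Un_le[of Y0 "\<Union>i\<in>I. Y i"] by linarith
  moreover have "finite ?Y" using assms Y by auto
  ultimately obtain A where A: "A \<in> \<A>" "A \<inter> ?Y = {}" using sp by (meson spreadD)
  then obtain i where "i \<in> I" "Q i A" using col by blast
  then show False using A Y by blast
qed

text \<open>Greedy choice: the points of the sets chosen so far join \<open>Y0\<close>, and the next
  family still has a member avoiding them all.\<close>

lemma select_disjoint:
  assumes "finite I" and "finite Y0" and "card Y0 + card I * m \<le> L"
    and sp: "\<And>i. i \<in> I \<Longrightarrow> spread L {F. P i F \<and> finite F \<and> card F \<le> m}"
  shows "\<exists>f. (\<forall>i\<in>I. P i (f i) \<and> finite (f i) \<and> card (f i) \<le> m \<and> f i \<inter> Y0 = {}) \<and>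
    disjoint_family_on f I"
  using assms(1,3,4)
proof (induction I rule: finite_induct)
  case empty
  then show ?case by (auto simp: disjoint_family_on_def)
next
  case (insert i I)
  have "card Y0 + card I * m \<le> L" using insert by auto
  then obtain f where f: "\<forall>i\<in>I. P i (f i) \<and> finite (f i) \<and> card (f i) \<le> m \<and> f i \<inter> Y0 = {}"
    "disjoint_family_on f I" using insert by blast
  let ?Y = "Y0 \<union> (\<Union>i\<in>I. f i)"
  have "card (\<Union>i\<in>I. f i) \<le> (\<Sum>i\<in>I. card (f i))" using insert by (intro card_UN_le)
  also have "\<dots> \<le> card I * m" using f sum_bounded_above[of I "\<lambda>i. card (f i)" m] by auto
  finally have "card ?Y \<le> card Y0 + card I * m"
    using card_Un_le[of Y0 "\<Union>i\<in>I. f i"] by linarith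
  then have "card ?Y \<le> L" using \<open>card Y0 + card I * m \<le> L\<close> by linarith
  moreover have "finite ?Y" using insert f assms by auto
  ultimately obtain F where F: "P i F" "finite F" "card F \<le> m" "F \<inter> ?Y = {}"
    using spreadD[OF insert.prems(2)[of i]] by blast
  have "disjoint_family_on (f(i := F)) (insert i I)"
    using f(2) F(4) insert(2) unfolding disjoint_family_on_def by (auto; blast)
  moreover have "\<forall>j\<in>insert i I. P j ((f(i := F)) j) \<and> finite ((f(i := F)) j) \<and>
      card ((f(i := F)) j) \<le> m \<and> (f(i := F)) j \<inter> Y0 = {}"
    using f F insert(2) by auto
  ultimately show ?case by blast
qed

section \<open>Families of positive density\<close>

lemma card_pigeonhole_UN:
  fixes c m :: real
  assumes "finite I" "real (card I) \<le> m" "c > 0" "m > 0" "c * m \<le> real (card S)"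
    and "S \<subseteq> (\<Union>i\<in>I. T i)" and "\<And>i. i \<in> I \<Longrightarrow> finite (T i)"
  shows "\<exists>i\<in>I. c \<le> real (card (T i))"
proof (rule ccontr)
  assume neg: "\<not> ?thesis"
  have pos: "0 < c * m" using assms by simp
  then have "S \<noteq> {}" using assms(5) by auto
  then have ne: "I \<noteq> {}" using assms(6) by auto
  have "card S \<le> card (\<Union>i\<in>I. T i)" using assms by (intro card_mono) auto
  also have "\<dots> \<le> (\<Sum>i\<in>I. card (T i))" by (rule card_UN_le[OF assms(1)])
  finally have "real (card S) \<le> (\<Sum>i\<in>I. real (card (T i)))"
    by (metis of_nat_le_iff of_nat_sum)
  also have "\<dots> < (\<Sum>i\<in>I. c)" using neg ne assms by (intro sum_strict_mono) auto
  also have "\<dots> = card I * c" by simp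
  also have "\<dots> \<le> m * c" using assms by (intro mult_right_mono) auto
  finally show False using assms by (simp add: mult.commute)
qed

lemma card_subsets_le_power:
  assumes "finite X"
  shows "card {F. F \<subseteq> X \<and> card F = m} \<le> card X ^ m"
  using n_subsets[OF assms, of m] binomial_le_pow[of m "card X"]
  by (cases "m \<le> card X") (simp_all add: binomial_eq_0)

text \<open>A point of \<open>Y\<close> and \<open>m - 1\<close> arbitrary further points give
  \<open>card Y * card X ^ (m - 1)\<close>; the extra factor \<open>card X\<close> keeps the bound
  meaningful for \<open>m = 0\<close>.\<close>

lemma card_subsets_meeting:
  assumes X: "finite X" and "finite Y"
  shows "card {F. F \<subseteq> X \<and> card F = m \<and> F \<inter> Y \<noteq> {}} * card X \<le> card Y * card X ^ m"
proof (cases m)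
  case 0
  have e: "{F. F \<subseteq> X \<and> card F = m \<and> F \<inter> Y \<noteq> {}} = {}"
    using 0 X by (auto dest: finite_subset)
  show ?thesis unfolding e by simp
next
  case (Suc k)
  let ?G = "{G. G \<subseteq> X \<and> card G = k}"
  have fG: "finite ?G" using X by simp
  have "{F. F \<subseteq> X \<and> card F = m \<and> F \<inter> Y \<noteq> {}} \<subseteq> (\<Union>y\<in>Y. insert y ` ?G)"
  proof
    fix F assume "F \<in> {F. F \<subseteq> X \<and> card F = m \<and> F \<inter> Y \<noteq> {}}"
    then obtain y where y: "y \<in> F" "y \<in> Y" "F \<subseteq> X" "card F = m" by auto
    have "card (F - {y}) = k" using y Suc finite_subset[OF y(3) X] by simp
    then have "F = insert y (F - {y})" "F - {y} \<in> ?G" using y by auto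
    then show "F \<in> (\<Union>y\<in>Y. insert y ` ?G)" using y by blast
  qed
  then have "card {F. F \<subseteq> X \<and> card F = m \<and> F \<inter> Y \<noteq> {}} \<le> card (\<Union>y\<in>Y. insert y ` ?G)"
    using assms fG by (intro card_mono) auto
  also have "\<dots> \<le> (\<Sum>y\<in>Y. card (insert y ` ?G))" by (rule card_UN_le[OF assms(2)])
  also have "\<dots> \<le> (\<Sum>y\<in>Y. card X ^ k)"
    by (intro sum_mono le_trans[OF card_image_le[OF fG] card_subsets_le_power[OF X]])
  finally show ?thesis using Suc by (simp add: mult.assoc mult.commute mult_le_mono)
qed

lemma dense_spread:
  fixes \<eta> :: real
  assumes X: "finite X" and d: "\<eta> * real (card X) ^ m \<le> real (card \<F>)"
    and sub: "\<And>F. F \<in> \<F> \<Longrightarrow> F \<subseteq> X \<and> card F = m" and n: "real L < \<eta> * real (card X)"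
  shows "spread L \<F>"
  unfolding spread_def
proof (intro allI impI, rule ccontr)
  fix Y assume Y: "finite Y \<and> card Y \<le> L" and "\<not> (\<exists>A\<in>\<F>. A \<inter> Y = {})"
  then have "\<F> \<subseteq> {F. F \<subseteq> X \<and> card F = m \<and> F \<inter> Y \<noteq> {}}" using sub by auto
  then have "card \<F> \<le> card {F. F \<subseteq> X \<and> card F = m \<and> F \<inter> Y \<noteq> {}}"
    using X by (intro card_mono) auto
  then have "card \<F> * card X \<le> card Y * card X ^ m"
    using card_subsets_meeting[OF X, of Y m] Y by (meson le_trans mult_le_mono1)
  also have "\<dots> \<le> L * card X ^ m" using Y by simp
  finally have "real (card \<F>) * real (card X) \<le> real L * real (card X) ^ m"
    by (metis of_nat_le_iff of_nat_mult of_nat_power)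
  moreover have "\<eta> * real (card X) ^ m * real (card X) \<le> real (card \<F>) * real (card X)"
    using d by (intro mult_right_mono) auto
  ultimately have "\<eta> * real (card X) * real (card X) ^ m \<le> real L * real (card X) ^ m"
    by (simp add: mult_ac)
  moreover have "card X > 0" using n by (cases "card X") auto
  ultimately show False using n by (simp add: mult_le_cancel_right)
qed

text \<open>Elements lying in fewer than \<open>s\<close> of the sets account for at most half of
  the incidences, so at least \<open>\<eta> / 2 * M\<close> elements lie in \<open>s\<close> or
  more. Each of these selects an \<open>s\<close>-subset \<open>J\<close> of the indices, and there
  are at most \<open>2 ^ N\<close> of them; these are the two losses in the density.\<close>

lemma dense_intersection:
  fixes \<eta> M :: real
  assumes fin: "finite \<U>" and M: "real (card \<U>) \<le> M" "M > 0"
    and X: "\<And>j. j < N \<Longrightarrow> \<X> j \<subseteq> \<U> \<and> \<eta> * M \<le> real (card (\<X> j))"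
    and N: "2 * real s \<le> real N * \<eta>" and "\<eta> > 0" "s > 0"
  shows "\<exists>J\<subseteq>{..<N}. card J = s \<and> \<eta> / 2 / 2 ^ N * M \<le> real (card (\<Inter>j\<in>J. \<X> j))"
proof -
  define d where "d F = card {j. j < N \<and> F \<in> \<X> j}" for F
  define V where "V = {F\<in>\<U>. s \<le> d F}"
  have Npos: "N > 0" using N \<open>s > 0\<close> by (cases N) auto
  have "(\<Sum>j<N. card (\<X> j)) = (\<Sum>j<N. \<Sum>F\<in>\<U>. if F \<in> \<X> j then 1 else 0)"
  proof (rule sum.cong[OF refl])
    fix j assume "j \<in> {..<N}"
    then have "\<X> j = {F\<in>\<U>. F \<in> \<X> j}" using X by auto
    then have "card (\<X> j) = card {F\<in>\<U>. F \<in> \<X> j}" by simp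
    also have "\<dots> = (\<Sum>F\<in>\<U>. if F \<in> \<X> j then 1 else 0)"
      using fin by (simp add: sum.If_cases Int_def)
    finally show "card (\<X> j) = (\<Sum>F\<in>\<U>. if F \<in> \<X> j then 1 else 0)" .
  qed
  also have "\<dots> = (\<Sum>F\<in>\<U>. \<Sum>j<N. if F \<in> \<X> j then 1 else 0)" by (rule sum.swap)
  also have "\<dots> = (\<Sum>F\<in>\<U>. d F)"
    by (intro sum.cong) (auto simp: d_def sum.If_cases Int_def)
  also have "\<dots> \<le> (\<Sum>F\<in>\<U>. s + (if F \<in> V then N else 0))"
  proof (rule sum_mono)
    fix F assume "F \<in> \<U>"
    have "d F \<le> card {..<N}" unfolding d_def by (intro card_mono) auto
    then show "d F \<le> s + (if F \<in> V then N else 0)" using \<open>F \<in> \<U>\<close> by (auto simp: V_def)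
  qed
  also have "\<dots> = card \<U> * s + card V * N"
  proof -
    have "\<U> \<inter> {F. s \<le> d F} = V" by (auto simp: V_def)
    then show ?thesis using fin by (simp add: sum.distrib sum.If_cases V_def)
  qed
  finally have "real (\<Sum>j<N. card (\<X> j)) \<le> real (card \<U> * s + card V * N)" by linarith
  moreover have "real N * (\<eta> * M) \<le> real (\<Sum>j<N. card (\<X> j))"
    using sum_mono[of "{..<N}" "\<lambda>_. \<eta> * M" "\<lambda>j. real (card (\<X> j))"] X by simp
  moreover have "real (card \<U>) * real s \<le> M * real s" using M by (intro mult_right_mono) auto
  moreover have "M * (2 * real s) \<le> M * (real N * \<eta>)" using N M by (intro mult_left_mono) auto
  ultimately have "real N * (\<eta> * M) \<le> M * (real N * \<eta>) / 2 + real (card V) * real N" by simp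
  then have "real N * (\<eta> / 2 * M) \<le> real N * real (card V)" by (simp add: field_simps)
  then have V: "\<eta> / 2 * M \<le> real (card V)" using Npos by simp
  let ?Js = "{J. J \<subseteq> {..<N} \<and> card J = s}"
  have fJ: "finite ?Js" by simp
  have "card ?Js \<le> card (Pow {..<N})" by (intro card_mono) auto
  then have cJ: "real (card ?Js) \<le> 2 ^ N"
    by (metis card_Pow card_lessThan finite_lessThan of_nat_le_iff of_nat_numeral of_nat_power)
  have "\<exists>J\<in>?Js. \<eta> / 2 / 2 ^ N * M \<le> real (card (\<Inter>j\<in>J. \<X> j))"
  proof (rule card_pigeonhole_UN[OF fJ cJ])
    show "V \<subseteq> (\<Union>J\<in>?Js. \<Inter>j\<in>J. \<X> j)"
    proof
      fix F assume "F \<in> V"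
      then obtain J where "J \<subseteq> {j. j < N \<and> F \<in> \<X> j}" "card J = s"
        unfolding V_def d_def by (metis (mono_tags, lifting) mem_Collect_eq obtain_subset_with_card_n)
      then have "J \<in> ?Js" "F \<in> (\<Inter>j\<in>J. \<X> j)" by auto
      then show "F \<in> (\<Union>J\<in>?Js. \<Inter>j\<in>J. \<X> j)" by blast
    qed
    fix J assume "J \<in> ?Js"
    then obtain j where "j \<in> J" "j < N" using \<open>s > 0\<close>
      by (metis (mono_tags, lifting) all_not_in_conv card.empty lessThan_iff mem_Collect_eq nat_neq_iff subsetD)
    then show "finite (\<Inter>j\<in>J. \<X> j)" using X[of j] fin by (meson INT_lower finite_subset)
  qed (use V assms in \<open>auto simp: mult_ac\<close>)
  then show ?thesis by blast
qed

section \<open>Ordering a tree\<close>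

text \<open>The steps of the path carry membership in \<open>Z\<close>, so that \<open>u\<close>
  cannot lie on it and closes it to a cycle.\<close>

lemma rtrancl_path_cycle:
  assumes path: "rtrancl_path (\<lambda>x y. {x, y} \<in> E \<and> x \<in> Z \<and> y \<in> Z) p xs p'"
    and dist: "distinct (p # xs)" and "p \<noteq> p'" and "p \<in> Z"
    and u: "u \<notin> Z" "{u, p} \<in> E" "{u, p'} \<in> E"
  shows "graph_cycle E (u # p # xs)"
proof -
  have ne: "xs \<noteq> []" using path \<open>p \<noteq> p'\<close> by (cases xs) (auto elim: rtrancl_path.cases)
  have last: "last xs = p'" using rtrancl_path_last[OF path ne] .
  have step: "{(p # xs) ! i, xs ! i} \<in> E" "xs ! i \<in> Z" if "i < length xs" for i
    using rtrancl_path_nth[OF path that] by auto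
  have "set xs \<subseteq> Z" using step by (auto simp: in_set_conv_nth)
  then have "distinct (u # p # xs)" using dist u \<open>p \<in> Z\<close> by auto
  moreover have "{(u # p # xs) ! i, (u # p # xs) ! (Suc i mod length (u # p # xs))} \<in> E"
    if "i < length (u # p # xs)" for i
  proof (cases "Suc i < length (u # p # xs)")
    case True
    then show ?thesis using u step[of "i - 1"] by (cases i) auto
  next
    case False
    then have "i = Suc (length xs)" using that by simp
    then show ?thesis using last ne u by (simp add: last_conv_nth insert_commute)
  qed
  ultimately show ?thesis using ne by (cases xs) (auto simp: graph_cycle_def)
qed

text \<open>Grows a subtree: while a vertex of \<open>U\<close> is missing, some edge leaves the
  current vertex set, and two edges from the new vertex back into it would close a cycle.
  Connectivity is part of the induction because that cycle needs a path inside the subtree.\<close>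

lemma tree_order_prefix:
  assumes tree: "tree_graph (U \<union> V) E" and bip: "bipartition (U \<union> V) E U V"
    and N: "\<And>u. N u = {v\<in>V. {u, v} \<in> E}" and "0 < k" "k \<le> card U"
  shows "\<exists>us. length us = k \<and> distinct us \<and> set us \<subseteq> U \<and>
    (\<forall>i. 0 < i \<and> i < k \<longrightarrow> (\<exists>v. N (us ! i) \<inter> \<Union>(N ` set (take i us)) = {v})) \<and>
    (\<exists>w\<in>set us \<union> \<Union>(N ` set us). \<forall>x\<in>set us \<union> \<Union>(N ` set us).
      (\<lambda>x y. {x, y} \<in> E \<and> x \<in> set us \<union> \<Union>(N ` set us) \<and> y \<in> set us \<union> \<Union>(N ` set us))\<^sup>*\<^sup>* w x)"
  using assms(4,5)
proof (induction k rule: nat_induct_non_zero)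
  case 1
  then obtain u where u: "u \<in> U" by (metis card.empty ex_in_conv le_zero_eq one_neq_zero)
  let ?Z = "{u} \<union> N u"
  have "(\<lambda>x y. {x, y} \<in> E \<and> x \<in> ?Z \<and> y \<in> ?Z)\<^sup>*\<^sup>* u x" if "x \<in> ?Z" for x
    using that N[of u] by (cases "x = u") (auto intro!: r_into_rtranclp)
  then show ?case using u by (intro exI[of _ "[u]"]) auto
next
  case (Suc k)
  then obtain us where us: "length us = k" "distinct us" "set us \<subseteq> U"
    "\<forall>i. 0 < i \<and> i < k \<longrightarrow> (\<exists>v. N (us ! i) \<inter> \<Union>(N ` set (take i us)) = {v})" and
    conn: "\<exists>w\<in>set us \<union> \<Union>(N ` set us). \<forall>x\<in>set us \<union> \<Union>(N ` set us).
      (\<lambda>x y. {x, y} \<in> E \<and> x \<in> set us \<union> \<Union>(N ` set us) \<and> y \<in> set us \<union> \<Union>(N ` set us))\<^sup>*\<^sup>* w x"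
    by auto
  define Z where "Z = set us \<union> \<Union>(N ` set us)"
  define R where "R S x y \<longleftrightarrow> {x, y} \<in> E \<and> x \<in> S \<and> y \<in> S" for S x y
  have UV: "U \<inter> V = {}" and EUV: "\<And>e. e \<in> E \<Longrightarrow> \<exists>u\<in>U. \<exists>v\<in>V. e = {u, v}"
    using bip by (auto simp: bipartition_def)
  obtain w where w: "w \<in> Z" "\<And>x. x \<in> Z \<Longrightarrow> (R Z)\<^sup>*\<^sup>* w x"
    using conn unfolding Z_def R_def by blast
  have NV: "\<Union>(N ` set us) \<subseteq> V" using N by auto
  obtain u0 where u0: "u0 \<in> set us" using us(1) \<open>0 < k\<close> by (cases us) auto
  have "card (set us) < card U" using us Suc.prems by (simp add: distinct_card)
  then obtain u1 where u1: "u1 \<in> U" "u1 \<notin> set us"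
    by (metis card_mono List.finite_set leD subsetI)
  have "(u0, u1) \<in> {(p, q). {p, q} \<in> E}\<^sup>*"
    using tree us(3) u0 u1 by (auto simp: tree_graph_def connected_graph_def)
  moreover have "u0 \<in> Z" using u0 by (auto simp: Z_def)
  moreover have "u1 \<notin> Z" using u1 NV UV by (auto simp: Z_def)
  ultimately have "\<exists>p q. p \<in> Z \<and> q \<notin> Z \<and> {p, q} \<in> E"
    by (induction rule: rtrancl_induct) auto
  then obtain p q where pq: "p \<in> Z" "q \<notin> Z" "{p, q} \<in> E" by blast
  \<comment> \<open>All neighbours of the chosen vertices of \<open>U\<close> are already in
    \<open>Z\<close>, so the leaving edge starts in \<open>V\<close> and ends in
    \<open>U\<close>.\<close>
  have q: "q \<in> U \<and> p \<in> V"
  proof (rule ccontr)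
    assume "\<not> ?thesis"
    then have "p \<in> U" "q \<in> V" using EUV[OF pq(3)] by (auto simp: doubleton_eq_iff)
    moreover from \<open>p \<in> U\<close> have "p \<in> set us" using pq(1) NV UV by (auto simp: Z_def)
    ultimately have "q \<in> Z" using N pq(3) by (auto simp: Z_def)
    then show False using pq by simp
  qed
  have pN: "p \<in> N q" "p \<in> \<Union>(N ` set us)"
    using pq q us(3) UV N by (auto simp: Z_def insert_commute)
  have "p' = p" if "p' \<in> N q" "p' \<in> \<Union>(N ` set us)" for p'
  proof (rule ccontr)
    assume "p' \<noteq> p"
    have sym: "symp (R Z)" by (auto simp: symp_def R_def insert_commute)
    have "(R Z)\<^sup>*\<^sup>* p w" using w(2)[OF pq(1)] symp_rtranclp[OF sym] by (auto dest: sympD)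
    moreover have "(R Z)\<^sup>*\<^sup>* w p'" using w(2) that by (auto simp: Z_def)
    ultimately have "(R Z)\<^sup>*\<^sup>* p p'" by simp
    then obtain xs where "rtrancl_path (R Z) p xs p'" by (auto simp: rtranclp_eq_rtrancl_path)
    then obtain xs where xs: "rtrancl_path (R Z) p xs p'" "distinct (p # xs)"
      by (rule rtrancl_path_distinct)
    have "graph_cycle E (q # p # xs)"
      by (rule rtrancl_path_cycle[of E Z p xs p'])
        (use xs pq pN \<open>p' \<noteq> p\<close> that N in \<open>auto simp: R_def [abs_def]\<close>)
    then show False using tree by (auto simp: tree_graph_def)
  qed
  then have uniq: "N q \<inter> \<Union>(N ` set us) = {p}" using pN by blast
  let ?us = "us @ [q]"
  define Z' where "Z' = set ?us \<union> \<Union>(N ` set ?us)"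
  have ZZ': "Z \<subseteq> Z'" by (auto simp: Z_def Z'_def)
  have mono: "(R Z')\<^sup>*\<^sup>* x y" if "(R Z)\<^sup>*\<^sup>* x y" for x y
    using that by (rule rtranclp_mono[THEN predicate2D, rotated]) (use ZZ' in \<open>auto simp: R_def\<close>)
  have wq: "(R Z')\<^sup>*\<^sup>* w q"
    using mono[OF w(2)[OF pq(1)]] pq ZZ'
    by (elim rtranclp.rtrancl_into_rtrancl) (auto simp: R_def Z'_def)
  have "(R Z')\<^sup>*\<^sup>* w x" if x: "x \<in> Z'" for x
  proof -
    consider "x \<in> Z" | "x = q" | "x \<in> N q" using x by (auto simp: Z_def Z'_def)
    then show ?thesis
    proof cases
      case 3
      then show ?thesis using wq by (elim rtranclp.rtrancl_into_rtrancl) (auto simp: R_def Z'_def N)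
    qed (use mono w wq in auto)
  qed
  then have conn': "\<exists>w\<in>Z'. \<forall>x\<in>Z'. (R Z')\<^sup>*\<^sup>* w x" using w ZZ' by blast
  have "\<exists>v. N (?us ! i) \<inter> \<Union>(N ` set (take i ?us)) = {v}" if "0 < i" "i < Suc k" for i
    using that us uniq by (cases "i = k") (auto simp: nth_append)
  moreover have "length ?us = Suc k" "distinct ?us" "set ?us \<subseteq> U"
    using us q pq by (auto simp: Z_def)
  ultimately show ?case using conn' unfolding Z'_def R_def by blast
qed

lemma tree_order:
  assumes tree: "tree_graph (U \<union> V) E" and bip: "bipartition (U \<union> V) E U V"
    and "finite U" "U \<noteq> {}"
  shows "\<exists>us. distinct us \<and> set us = U \<and>
    (\<forall>i. 0 < i \<and> i < length us \<longrightarrow>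
      (\<exists>v. {v\<in>V. {us ! i, v} \<in> E} \<inter> (\<Union>u\<in>set (take i us). {v\<in>V. {u, v} \<in> E}) = {v}))"
proof -
  have "0 < card U" using assms by (simp add: card_gt_0_iff)
  from tree_order_prefix[OF tree bip refl this le_refl] obtain us where
    us: "length us = card U" "distinct us" "set us \<subseteq> U"
    "\<forall>i. 0 < i \<and> i < card U \<longrightarrow>
      (\<exists>v. {v\<in>V. {us ! i, v} \<in> E} \<inter> \<Union>((\<lambda>u. {v\<in>V. {u, v} \<in> E}) ` set (take i us)) = {v})"
    by blast
  moreover have "set us = U" using us assms(3) by (metis card_subset_eq distinct_card)
  ultimately show ?thesis by auto
qed

lemma tree_neighbour:
  assumes tree: "tree_graph W E" and x: "x \<in> W" and y: "y \<in> W" "x \<noteq> y"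
  shows "\<exists>z. {x, z} \<in> E"
proof -
  have "(x, y) \<in> {(p, q). {p, q} \<in> E}\<^sup>*"
    using tree x y by (auto simp: tree_graph_def connected_graph_def)
  then show ?thesis using y(2) by (cases rule: converse_rtranclE) auto
qed

section \<open>Embedding the blowup block by block\<close>

locale blowup_tree =
  fixes U V :: "'v set" and N :: "'v \<Rightarrow> 'v set" and us :: "'v list" and a b t :: nat
  assumes finite_V: "finite V" and card_V: "card V = t" and UV: "U \<inter> V = {}"
    and us: "distinct us" "set us = U"
    and N_sub: "\<And>u. u \<in> U \<Longrightarrow> N u \<subseteq> V" and N_cover: "\<Union>(N ` U) = V"
    and N_uniq: "\<And>i. 0 < i \<Longrightarrow> i < length us \<Longrightarrow>
      \<exists>v. N (us ! i) \<inter> \<Union>(N ` set (take i us)) = {v}"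
    and ab: "0 < b" "b < a" and t_pos: "0 < t"
begin

definition pre :: "nat \<Rightarrow> 'v set" where "pre k = set (take k us)"

definition NZ :: "nat \<Rightarrow> 'v set" where "NZ k = \<Union>(N ` pre k)"

text \<open>\<open>card U * a + t * b\<close> bounds the vertices of a partial copy; the further
  \<open>t\<close> leaves room for centres that are reserved before their blocks are filled.\<close>

definition \<Omega> :: nat where "\<Omega> = card U * a + t + t * b"

text \<open>\<open>c v\<close> is a marked vertex of the block of \<open>v\<close>; in the main application it is the
  common centre of all edges of the copy that contain this block.\<close>

definition emb :: "('x set \<Rightarrow> 'x set \<Rightarrow> 'x \<Rightarrow> bool) \<Rightarrow> nat \<Rightarrow> ('v \<Rightarrow> 'x set) \<Rightarrow> ('v \<Rightarrow> 'x) \<Rightarrow> bool" where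
  "emb R k \<phi> c \<longleftrightarrow> disjoint_family_on \<phi> (pre k \<union> NZ k) \<and> (\<forall>u\<in>pre k. card (\<phi> u) = a) \<and>
     (\<forall>v\<in>NZ k. card (\<phi> v) = b \<and> c v \<in> \<phi> v) \<and> (\<forall>u\<in>pre k. \<forall>v\<in>N u. R (\<phi> u) (\<phi> v) (c v))"

lemma pre_sub: "pre k \<subseteq> U" using us set_take_subset[of k us] by (auto simp: pre_def)
lemma NZ_sub: "NZ k \<subseteq> V" using pre_sub N_sub by (auto simp: NZ_def)
lemma pre_NZ: "pre k \<inter> NZ j = {}" using pre_sub[of k] NZ_sub[of j] UV by blast
lemma finite_U: "finite U" using us by auto
lemma finite_pre: "finite (pre k)" by (simp add: pre_def)
lemma finite_NZ: "finite (NZ k)" using NZ_sub finite_V finite_subset by blast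
lemma card_NZ: "card (NZ k) \<le> t" using NZ_sub card_V finite_V card_mono by blast
lemma pre_Suc: "k < length us \<Longrightarrow> pre (Suc k) = insert (us ! k) (pre k)"
  by (simp add: pre_def take_Suc_conv_app_nth)
lemma NZ_Suc: "k < length us \<Longrightarrow> NZ (Suc k) = N (us ! k) \<union> NZ k"
  by (simp add: NZ_def pre_Suc)
lemma us_in: "k < length us \<Longrightarrow> us ! k \<in> U" using us by auto
lemma us_notin_pre: "k < length us \<Longrightarrow> us ! k \<notin> pre k"
  using us by (auto simp: pre_def in_set_conv_nth nth_eq_iff_index_eq)
lemma length_us: "length us = card U" using us distinct_card by metis
lemma card_pre: "k \<le> length us \<Longrightarrow> card (pre k) = k"
  using us by (simp add: pre_def distinct_card)

text \<open>Both sets are disjoint parts of \<open>V\<close>. Hence \<open>t\<close> centres can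
  serve the new neighbours unless more than \<open>card (NZ k)\<close> of them are already in
  use.\<close>

lemma card_N_NZ:
  assumes "k < length us"
  shows "card (N (us ! k) - NZ k) + card (NZ k) \<le> t"
proof -
  have "N (us ! k) \<subseteq> V" by (intro N_sub us_in assms)
  then have "finite (N (us ! k) - NZ k)" using finite_V finite_subset by blast
  then have "card (N (us ! k) - NZ k) + card (NZ k) = card (NZ (Suc k))"
    using finite_NZ by (subst NZ_Suc[OF assms], subst card_Un_disjoint[symmetric]) auto
  then show ?thesis using card_NZ[of "Suc k"] by simp
qed

lemma emb_finite:
  assumes "emb R k \<phi> c" "x \<in> pre k \<union> NZ k"
  shows "finite (\<phi> x)"
  using assms ab by (auto simp: emb_def intro: card_ge_0_finite)

lemma emb_image:
  assumes e: "emb R k \<phi> c"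
  shows "finite (\<Union>(\<phi> ` (pre k \<union> NZ k)))" "card (\<Union>(\<phi> ` (pre k \<union> NZ k))) \<le> \<Omega>"
proof -
  have fin: "finite (pre k \<union> NZ k)" using finite_pre finite_NZ by simp
  then show "finite (\<Union>(\<phi> ` (pre k \<union> NZ k)))" using emb_finite[OF e] by blast
  have "card (\<Union>(\<phi> ` (pre k \<union> NZ k))) \<le> (\<Sum>x\<in>pre k \<union> NZ k. card (\<phi> x))"
    by (rule card_UN_le[OF fin])
  also have "\<dots> = (\<Sum>x\<in>pre k. card (\<phi> x)) + (\<Sum>x\<in>NZ k. card (\<phi> x))"
    by (intro sum.union_disjoint finite_pre finite_NZ pre_NZ)
  also have "\<dots> = card (pre k) * a + card (NZ k) * b" using e by (simp add: emb_def)
  also have "\<dots> \<le> card U * a + t * b"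
    using card_mono[OF finite_U pre_sub] card_NZ by (intro add_mono mult_right_mono) auto
  finally show "card (\<Union>(\<phi> ` (pre k \<union> NZ k))) \<le> \<Omega>" by (simp add: \<Omega>_def)
qed

lemma emb_0: "emb R 0 \<phi> c"
  by (simp add: emb_def pre_def NZ_def disjoint_family_on_def)

text \<open>\<open>R\<close> is arbitrary so that one gluing argument serves both plain splits
  \<open>(A, B)\<close> and centred edges.\<close>

lemma emb_Suc:
  assumes e: "emb R k \<phi> c" and k: "k < length us"
    and A: "card A = a" "A \<inter> \<Union>(\<phi> ` (pre k \<union> NZ k)) = {}"
    and old: "\<And>v. v \<in> N (us ! k) \<inter> NZ k \<Longrightarrow> R A (\<phi> v) (c v)"
    and dis: "disjoint_family_on \<beta> (N (us ! k) - NZ k)"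
    and new: "\<And>v. v \<in> N (us ! k) - NZ k \<Longrightarrow> card (\<beta> v) = b \<and> \<gamma> v \<in> \<beta> v \<and>
      \<beta> v \<inter> (A \<union> \<Union>(\<phi> ` (pre k \<union> NZ k))) = {} \<and> R A (\<beta> v) (\<gamma> v)"
  shows "\<exists>\<phi>' c'. emb R (Suc k) \<phi>' c'"
proof -
  let ?u = "us ! k"
  define \<phi>' where "\<phi>' x = (if x = ?u then A else if x \<in> N ?u - NZ k then \<beta> x else \<phi> x)" for x
  define c' where "c' x = (if x \<in> N ?u - NZ k then \<gamma> x else c x)" for x
  have uV: "?u \<notin> V" using us_in[OF k] UV by auto
  have NuV: "N ?u \<subseteq> V" by (intro N_sub us_in k)
  have u: "?u \<notin> NZ k" using uV NZ_sub by auto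
  have preV: "pre k \<inter> V = {}" using pre_sub UV by auto
  have old': "\<phi>' x = \<phi> x" if "x \<in> pre k \<union> NZ k" for x
    using that us_notin_pre[OF k] u preV NuV by (auto simp: \<phi>'_def)
  have new': "\<phi>' x = \<beta> x" if "x \<in> N ?u - NZ k" for x
    using that uV NuV by (auto simp: \<phi>'_def)
  have u': "\<phi>' ?u = A" by (simp add: \<phi>'_def)
  define O1 where "O1 = pre k \<union> NZ k"
  define N1 where "N1 = N ?u - NZ k"
  have split: "pre (Suc k) \<union> NZ (Suc k) = insert ?u (N1 \<union> O1)"
    using k by (auto simp: pre_Suc NZ_Suc O1_def N1_def)
  have d1: "\<phi>' x \<inter> \<phi>' y = {}" if "x \<in> O1" "y \<in> O1" "x \<noteq> y" for x y
    using e that by (simp add: emb_def disjoint_family_on_def old'[folded O1_def] flip: O1_def)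
  have d2: "\<phi>' x \<inter> \<phi>' y = {}" if "x \<in> N1" "y \<in> N1" "x \<noteq> y" for x y
    using dis that by (simp add: disjoint_family_on_def new'[folded N1_def] flip: N1_def)
  have d3: "\<phi>' x \<inter> \<phi>' y = {}" "\<phi>' y \<inter> \<phi>' x = {}" if "x \<in> N1" "y \<in> O1" for x y
    using new[folded N1_def O1_def, OF that(1)] that
    by (auto simp: new'[folded N1_def] old'[folded O1_def])
  have d4: "\<phi>' ?u \<inter> \<phi>' y = {}" "\<phi>' y \<inter> \<phi>' ?u = {}" if "y \<in> O1" for y
    using A(2) that by (auto simp: u' old'[folded O1_def] simp flip: O1_def)
  have d5: "\<phi>' ?u \<inter> \<phi>' y = {}" "\<phi>' y \<inter> \<phi>' ?u = {}" if "y \<in> N1" for y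
    using new[folded N1_def, OF that] that by (auto simp: u' new'[folded N1_def])
  have "disjoint_family_on \<phi>' (pre (Suc k) \<union> NZ (Suc k))"
    unfolding disjoint_family_on_def split
    using d1 d2 d3 d4 d5 by (intro ballI impI) (elim insertE UnE, simp_all)
  moreover have "\<forall>u\<in>pre (Suc k). card (\<phi>' u) = a"
    using e A old' u' k by (auto simp: emb_def pre_Suc)
  moreover have "card (\<phi>' v) = b \<and> c' v \<in> \<phi>' v" if "v \<in> NZ (Suc k)" for v
  proof (cases "v \<in> NZ k")
    case True
    then show ?thesis using e old' by (auto simp: emb_def c'_def)
  next
    case False
    then have "v \<in> N ?u - NZ k" using that k by (auto simp: NZ_Suc)
    then show ?thesis using new[of v] by (simp add: new' c'_def)
  qed
  moreover have "R (\<phi>' u) (\<phi>' v) (c' v)" if "u \<in> pre (Suc k)" "v \<in> N u" for u v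
  proof (cases "u \<in> pre k")
    case True
    then have "v \<in> NZ k" using that by (auto simp: NZ_def)
    then show ?thesis using True e that old' by (auto simp: emb_def c'_def)
  next
    case False
    then have "u = ?u" using that k by (auto simp: pre_Suc)
    then show ?thesis using that old[of v] new[of v] old'[of v] new'[of v] u'
      by (cases "v \<in> NZ k") (auto simp: c'_def)
  qed
  ultimately show ?thesis by (intro exI[of _ \<phi>'] exI[of _ c']) (simp add: emb_def)
qed

lemma emb_contains_copy:
  assumes e: "emb R (length us) \<phi> c" and R: "\<And>A B x. R A B x \<Longrightarrow> A \<union> B \<in> H"
    and NE: "\<And>u. u \<in> U \<Longrightarrow> N u = {v\<in>V. {u, v} \<in> E}"
  shows "contains_copy H (blowup a b U V E)"
proof -
  have pU: "pre (length us) = U" by (simp add: pre_def us)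
  have pV: "NZ (length us) = V" by (simp add: NZ_def pU N_cover)
  define m where "m x = (if x \<in> U then a else b)" for x
  have "\<exists>g. bij_betw g {..<m x} (\<phi> x)" if "x \<in> U \<union> V" for x
  proof -
    have "finite (\<phi> x)" using emb_finite[OF e, of x] that pU pV by auto
    moreover have "card (\<phi> x) = m x" using e that UV by (auto simp: emb_def pU pV m_def)
    ultimately show ?thesis using ex_bij_betw_nat_finite[of "\<phi> x"] by (simp add: atLeast0LessThan)
  qed
  then obtain g where g: "\<And>x. x \<in> U \<union> V \<Longrightarrow> bij_betw (g x) {..<m x} (\<phi> x)" by metis
  define \<psi> where "\<psi> p = g (fst p) (snd p)" for p :: "'v \<times> nat"
  have img: "\<psi> ` ({x} \<times> {..<m x}) = \<phi> x" if "x \<in> U \<union> V" for x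
    using g[OF that] by (force simp: \<psi>_def bij_betw_def image_iff)
  have "inj_on \<psi> (Sigma (U \<union> V) (\<lambda>x. {..<m x}))"
  proof (rule inj_onI, clarify)
    fix x i y j
    assume xy: "x \<in> U \<union> V" "y \<in> U \<union> V" "i < m x" "j < m y" "\<psi> (x, i) = \<psi> (y, j)"
    have "\<psi> (x, i) \<in> \<phi> x" "\<psi> (y, j) \<in> \<phi> y" using img[OF xy(1)] img[OF xy(2)] xy by blast+
    then have "\<phi> x \<inter> \<phi> y \<noteq> {}" using xy(5) by auto
    moreover have "disjoint_family_on \<phi> (U \<union> V)" using e pU pV by (simp add: emb_def)
    ultimately have "x = y" using xy(1,2) disjoint_family_onD by metis
    moreover have "inj_on (g x) {..<m x}" using g[OF xy(1)] by (rule bij_betw_imp_inj_on)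
    ultimately have "i = j" using xy by (auto simp: \<psi>_def inj_on_def)
    with \<open>x = y\<close> show "x = y \<and> i = j" by simp
  qed
  moreover have "\<Union>(blowup a b U V E) \<subseteq> Sigma (U \<union> V) (\<lambda>x. {..<m x})"
    using UV by (auto simp: blowup_def m_def)
  ultimately have "inj_on \<psi> (\<Union>(blowup a b U V E))" by (rule inj_on_subset)
  moreover have "\<psi> ` S \<in> H" if S: "S \<in> blowup a b U V E" for S
  proof -
    obtain u v where uv: "u \<in> U" "v \<in> V" "{u, v} \<in> E" "S = {u} \<times> {..<a} \<union> {v} \<times> {..<b}"
      using S by (auto simp: blowup_def)
    have "v \<notin> U" using uv UV by auto
    then have "\<psi> ` S = \<phi> u \<union> \<phi> v"
      using img[of u] img[of v] uv by (simp add: m_def image_Un)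
    moreover have "v \<in> N u" using NE uv by auto
    then have "R (\<phi> u) (\<phi> v) (c v)" using e uv(1) by (simp add: emb_def pU)
    ultimately show ?thesis using R by simp
  qed
  ultimately show ?thesis by (auto simp: contains_copy_def)
qed

text \<open>With both parts of every split extending freely there is no shortage: a block of
  \<open>U\<close> fitting its unique embedded neighbour, and then its new neighbours one by one,
  can be chosen to avoid all vertices in use.\<close>

lemma emb_greedy:
  assumes ne: "K \<noteq> {}"
    and sz: "\<And>A B. (A, B) \<in> K \<Longrightarrow> card A = a \<and> card B = b"
    and spA: "\<And>A B. (A, B) \<in> K \<Longrightarrow> spread (3 * \<Omega>) {B'. (A, B') \<in> K \<and> A \<inter> B' = {}}"
    and spB: "\<And>A B. (A, B) \<in> K \<Longrightarrow> spread (3 * \<Omega>) {A'. (A', B) \<in> K}"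
    and "k \<le> length us"
  shows "\<exists>\<phi> c. emb (\<lambda>A B x. (A, B) \<in> K) k \<phi> c"
  using assms(5)
proof (induction k)
  case 0
  then show ?case using emb_0 by blast
next
  case (Suc k)
  then obtain \<phi> c where e: "emb (\<lambda>A B x. (A, B) \<in> K) k \<phi> c" and k: "k < length us" by auto
  let ?R = "\<lambda>A B x. (A, B) \<in> K"
  let ?u = "us ! k"
  let ?W = "\<Union>(\<phi> ` (pre k \<union> NZ k))"
  have W: "finite ?W" "card ?W \<le> 3 * \<Omega>" using emb_image[OF e] by auto
  have "\<exists>A. A \<inter> ?W = {} \<and> (\<exists>B. (A, B) \<in> K) \<and> (\<forall>v\<in>N ?u \<inter> NZ k. (A, \<phi> v) \<in> K)"
  proof (cases "k = 0")
    case True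
    then show ?thesis using ne by (auto simp: pre_def NZ_def)
  next
    case False
    then obtain v where v: "N ?u \<inter> NZ k = {v}" using N_uniq[of k] k by (auto simp: NZ_def pre_def)
    then obtain u' where "u' \<in> pre k" "v \<in> N u'" by (auto simp: NZ_def)
    then have "(\<phi> u', \<phi> v) \<in> K" using e by (auto simp: emb_def)
    then show ?thesis using spreadD[OF spB W] v by (metis (no_types, lifting) mem_Collect_eq singletonD)
  qed
  then obtain A B where A: "A \<inter> ?W = {}" "(A, B) \<in> K" "\<forall>v\<in>N ?u \<inter> NZ k. (A, \<phi> v) \<in> K" by blast
  have cA: "card A = a" using sz A by blast
  then have fA: "finite A" using ab by (intro card_ge_0_finite) auto
  let ?I = "N ?u - NZ k"
  have fI: "finite ?I" using N_sub[OF us_in[OF k]] finite_V finite_subset by blast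
  have cI: "card ?I \<le> t" using card_N_NZ[OF k] by simp
  \<comment> \<open>Budget: at most \<open>a + \<Omega>\<close> vertices in use and
    \<open>\<Omega>\<close> for the new blocks, where \<open>a \<le> \<Omega>\<close> because
    \<open>U\<close> is nonempty.\<close>
  have "card (A \<union> ?W) \<le> a + \<Omega>" using card_Un_le[of A ?W] cA emb_image[OF e] by linarith
  moreover have "a \<le> \<Omega>" using k length_us by (cases "card U") (auto simp: \<Omega>_def)
  moreover have "card ?I * b \<le> \<Omega>" using cI by (auto simp: \<Omega>_def intro: trans_le_add2)
  ultimately have sz': "card (A \<union> ?W) + card ?I * b \<le> 3 * \<Omega>" by simp
  have "spread (3 * \<Omega>) {B'. ((A, B') \<in> K \<and> A \<inter> B' = {}) \<and> finite B' \<and> card B' \<le> b}"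
    by (rule spread_antimono[OF spA[OF A(2)] le_refl])
      (use sz ab in \<open>auto intro: card_ge_0_finite\<close>)
  from select_disjoint[OF fI _ sz', of "\<lambda>_ B'. (A, B') \<in> K \<and> A \<inter> B' = {}", OF _ this]
  obtain \<beta> where \<beta>: "\<forall>v\<in>?I. ((A, \<beta> v) \<in> K \<and> A \<inter> \<beta> v = {}) \<and> finite (\<beta> v) \<and> card (\<beta> v) \<le> b \<and>
      \<beta> v \<inter> (A \<union> ?W) = {}" "disjoint_family_on \<beta> ?I"
    using fA W by auto
  \<comment> \<open>\<open>emb\<close> asks for a marked vertex in each block of \<open>V\<close>;
    an arbitrary one is taken.\<close>
  have \<beta>': "card (\<beta> v) = b \<and> (SOME x. x \<in> \<beta> v) \<in> \<beta> v \<and> \<beta> v \<inter> (A \<union> ?W) = {} \<and> (A, \<beta> v) \<in> K"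
    if "v \<in> ?I" for v
  proof -
    have K: "(A, \<beta> v) \<in> K" and d: "\<beta> v \<inter> (A \<union> ?W) = {}" using \<beta>(1) that by blast+
    from sz[OF K] have "card (\<beta> v) = b" by simp
    moreover from this have "\<beta> v \<noteq> {}" using ab by auto
    ultimately show ?thesis using K d by (simp add: some_in_eq)
  qed
  show ?case
    by (rule emb_Suc[OF e k cA A(1) _ \<beta>(2) \<beta>']) (use A in auto)
qed

end

section \<open>Stable systems of centred edges\<close>

definition centred :: "('x set \<times> 'x) set \<Rightarrow> 'x set \<Rightarrow> 'x set \<Rightarrow> 'x \<Rightarrow> bool" where
  "centred K A B x \<longleftrightarrow> (A \<union> B, x) \<in> K"

text \<open>Smaller than the codegree of \<open>P\<close> in the hypergraph: the completing vertex
  must also be the centre of a remaining pair.\<close>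

definition codeg :: "('x set \<times> 'x) set \<Rightarrow> 'x set \<Rightarrow> 'x set" where
  "codeg K P = {x. x \<notin> P \<and> (insert x P, x) \<in> K}"

definition cent :: "('x set \<times> 'x) set \<Rightarrow> 'x set \<Rightarrow> 'x set" where
  "cent K A = {x. \<exists>e. (e, x) \<in> K \<and> A \<subseteq> e \<and> x \<notin> A}"

context blowup_tree
begin

text \<open>The last three clauses say that rules (i), (ii) and (iii) no longer apply. As
  \<open>S\<close> is a proper subset of \<open>e\<close>, the size \<open>a + 1\<close> is void for
  \<open>b = 1\<close>, where a block of \<open>U\<close> with its centre is already a full
  edge.\<close>

definition stable :: "'x set \<Rightarrow> ('x set \<times> 'x) set \<Rightarrow> nat \<Rightarrow> real \<Rightarrow> bool" where
  "stable X K L \<delta> \<longleftrightarrow> finite X \<and>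
     (\<forall>e c. (e, c) \<in> K \<longrightarrow> e \<subseteq> X \<and> card e = a + b \<and> c \<in> e) \<and>
     (\<forall>e c. (e, c) \<in> K \<longrightarrow> t \<le> card (codeg K (e - {c}))) \<and>
     (\<forall>e c S. (e, c) \<in> K \<longrightarrow> c \<in> S \<longrightarrow> S \<subset> e \<longrightarrow> card S = b \<or> card S = a + 1 \<longrightarrow>
        spread L {e' - S | e'. (e', c) \<in> K \<and> S \<subseteq> e'}) \<and>
     (\<forall>e c A. (e, c) \<in> K \<longrightarrow> A \<subseteq> e \<longrightarrow> c \<notin> A \<longrightarrow> card A = a \<longrightarrow>
        \<delta> * real (card X) ^ (b - 1) \<le> real (card {p\<in>K. A \<subseteq> fst p \<and> snd p \<notin> A}))"

text \<open>The sets \<open>F\<close> which turn \<open>A\<close> into a block of size \<open>r - 1\<close> that all of \<open>\<Theta>\<close> can complete as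
  centres. A configuration consists of many blocks \<open>A\<close> for which these \<open>F\<close> have positive density;
  if \<open>card \<Theta> \<ge> t\<close>, it contains the blowup of a complete bipartite graph.\<close>

definition FA :: "'x set \<Rightarrow> ('x set \<times> 'x) set \<Rightarrow> 'x set \<Rightarrow> 'x set \<Rightarrow> 'x set set" where
  "FA X K \<Theta> A = {F. F \<subseteq> X \<and> card F = b - 1 \<and> F \<inter> A = {} \<and>
     (\<forall>x\<in>\<Theta>. x \<notin> A \<union> F \<and> (insert x (A \<union> F), x) \<in> K)}"

definition config :: "'x set \<Rightarrow> ('x set \<times> 'x) set \<Rightarrow> 'x set \<Rightarrow> nat \<Rightarrow> real \<Rightarrow> bool" where
  "config X K \<Theta> \<Lambda> \<eta> \<longleftrightarrow> finite \<Theta> \<and>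
     spread \<Lambda> {A. card A = a \<and> \<eta> * real (card X) ^ (b - 1) \<le> real (card (FA X K \<Theta> A))}"

lemma stableD:
  assumes "stable X K L \<delta>"
  shows "finite X"
    and "\<And>e c. (e, c) \<in> K \<Longrightarrow> e \<subseteq> X \<and> card e = a + b \<and> c \<in> e \<and> finite e"
    and "\<And>e c. (e, c) \<in> K \<Longrightarrow> t \<le> card (codeg K (e - {c}))"
    and "\<And>e c S. (e, c) \<in> K \<Longrightarrow> c \<in> S \<Longrightarrow> S \<subset> e \<Longrightarrow> card S = b \<or> card S = a + 1 \<Longrightarrow>
        spread L {e' - S | e'. (e', c) \<in> K \<and> S \<subseteq> e'}"
    and "\<And>e c A. (e, c) \<in> K \<Longrightarrow> A \<subseteq> e \<Longrightarrow> c \<notin> A \<Longrightarrow> card A = a \<Longrightarrow>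
        \<delta> * real (card X) ^ (b - 1) \<le> real (card {p\<in>K. A \<subseteq> fst p \<and> snd p \<notin> A})"
proof -
  note s = assms[unfolded stable_def]
  show "finite X" using s by (elim conjE)
  then show "e \<subseteq> X \<and> card e = a + b \<and> c \<in> e \<and> finite e" if "(e, c) \<in> K" for e c
    using s that by (meson finite_subset)
  show "t \<le> card (codeg K (e - {c}))" if "(e, c) \<in> K" for e c
    using s that by (elim conjE) simp
  show "spread L {e' - S | e'. (e', c) \<in> K \<and> S \<subseteq> e'}"
    if "(e, c) \<in> K" "c \<in> S" "S \<subset> e" "card S = b \<or> card S = a + 1" for e c S
    using s[THEN conjunct2, THEN conjunct2, THEN conjunct2, THEN conjunct1, rule_format, OF that] .
  show "\<delta> * real (card X) ^ (b - 1) \<le> real (card {p\<in>K. A \<subseteq> fst p \<and> snd p \<notin> A})"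
    if "(e, c) \<in> K" "A \<subseteq> e" "c \<notin> A" "card A = a" for e c A
    using s[THEN conjunct2, THEN conjunct2, THEN conjunct2, THEN conjunct2, rule_format, OF that] .
qed

lemma stable_antimono:
  assumes "stable X K L \<delta>" "M \<le> L"
  shows "stable X K M \<delta>"
  unfolding stable_def
  by (intro conjI allI impI stableD(1,3,5)[OF assms(1)]
      spread_antimono[OF stableD(4)[OF assms(1)] assms(2) order_refl])
    (simp_all add: stableD(2)[OF assms(1)])

lemma finite_FA: "finite X \<Longrightarrow> finite (FA X K \<Theta> A)"
  by (rule finite_subset[of _ "Pow X"]) (auto simp: FA_def)

lemma cent_sub:
  assumes "stable X K L \<delta>"
  shows "cent K A \<subseteq> X" and "finite (cent K A)"
proof -
  show "cent K A \<subseteq> X" using stableD(2)[OF assms] by (auto simp: cent_def)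
  then show "finite (cent K A)" using stableD(1)[OF assms] finite_subset by blast
qed

lemma codeg_cent: "codeg K (A \<union> F) \<subseteq> cent K A"
  by (auto simp: codeg_def cent_def)

lemma codeg_card:
  assumes "stable X K L \<delta>" "x \<in> codeg K P"
  shows "t \<le> card (codeg K P)"
proof -
  have "(insert x P, x) \<in> K" "insert x P - {x} = P" using assms(2) by (auto simp: codeg_def)
  then show ?thesis using stableD(3)[OF assms(1), of "insert x P" x] by simp
qed

text \<open>This is the clause for (ii) with \<open>S = insert x A\<close>, of size
  \<open>a + 1\<close>. For \<open>b = 1\<close> that set is the whole edge and the family contains
  the empty set.\<close>

lemma centre_block:
  assumes st: "stable X K L \<delta>" and x: "x \<in> cent K A" and A: "card A = a"
  shows "spread L {F. (card F = b - 1 \<and> F \<inter> A = {} \<and> x \<notin> F \<and> (insert x (A \<union> F), x) \<in> K) \<and>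
    finite F \<and> card F \<le> b - 1}"
proof -
  obtain e where e: "(e, x) \<in> K" "A \<subseteq> e" "x \<notin> A" using x by (auto simp: cent_def)
  note * = stableD(2)[OF st e(1)]
  have fA: "finite A" using ab A by (intro card_ge_0_finite) auto
  have cS: "card (insert x A) = a + 1" using e A fA by simp
  have sub: "insert x A \<subseteq> e" using e * by auto
  show ?thesis
  proof (cases "b = 1")
    case True
    then have "insert x A = e" using * cS sub by (metis card_subset_eq)
    then show ?thesis using e True by (auto simp: spread_def intro!: exI[of _ "{}"])
  next
    case False
    then have "insert x A \<noteq> e" using * cS ab by auto
    then have "insert x A \<subset> e" using sub by auto
    from stableD(4)[OF st e(1) insertI1 this] cS
    have sp: "spread L {e' - insert x A | e'. (e', x) \<in> K \<and> insert x A \<subseteq> e'}" by simp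
    show ?thesis
    proof (rule spread_antimono[OF sp le_refl], clarify)
      fix e' assume e': "(e', x) \<in> K" "insert x A \<subseteq> e'"
      note ** = stableD(2)[OF st e'(1)]
      have "card (e' - insert x A) = b - 1" using ** cS e'(2) fA by (simp add: card_Diff_subset)
      moreover have "insert x (A \<union> (e' - insert x A)) = e'" using e' by auto
      ultimately show "(card (e' - insert x A) = b - 1 \<and> (e' - insert x A) \<inter> A = {} \<and>
          x \<notin> e' - insert x A \<and> (insert x (A \<union> (e' - insert x A)), x) \<in> K) \<and>
          finite (e' - insert x A) \<and> card (e' - insert x A) \<le> b - 1"
        using ** e' by auto
    qed
  qed
qed

text \<open>Distinct centres outside the current copy are reserved for the new neighbours first;
  only then are their blocks filled up, by sets avoiding all reserved centres as well.\<close>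

lemma emb_Suc_centres:
  assumes st: "stable X K L \<delta>" and L: "3 * \<Omega> \<le> L"
    and e: "emb (centred K) k \<phi> c" and k: "k < length us"
    and A: "card A = a" "A \<inter> \<Union>(\<phi> ` (pre k \<union> NZ k)) = {}"
    and old: "\<And>v. v \<in> N (us ! k) \<inter> NZ k \<Longrightarrow> (A \<union> \<phi> v, c v) \<in> K"
    and many: "card (N (us ! k) - NZ k) \<le> card (cent K A - \<Union>(\<phi> ` (pre k \<union> NZ k)))"
  shows "\<exists>\<phi>' c'. emb (centred K) (Suc k) \<phi>' c'"
proof -
  let ?W = "\<Union>(\<phi> ` (pre k \<union> NZ k))"
  let ?I = "N (us ! k) - NZ k"
  have W: "finite ?W" "card ?W \<le> \<Omega>" using emb_image[OF e] by auto
  have fA: "finite A" using ab A by (intro card_ge_0_finite) auto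
  have fI: "finite ?I" using N_sub[OF us_in[OF k]] finite_V finite_subset by blast
  have cI: "card ?I \<le> t" using card_N_NZ[OF k] by simp
  obtain g where g: "inj_on g ?I" "g ` ?I \<subseteq> cent K A - ?W"
    using inj_on_iff_card_le[OF fI, of "cent K A - ?W"] many cent_sub[OF st] by auto
  have gA: "g v \<in> cent K A" "g v \<notin> ?W" "g v \<notin> A" if "v \<in> ?I" for v
    using g(2) that by (auto simp: cent_def)
  let ?Y = "A \<union> ?W \<union> g ` ?I"
  have Y: "card ?Y \<le> a + \<Omega> + t"
    using card_Un_le[of "A \<union> ?W" "g ` ?I"] card_Un_le[of A ?W] card_image_le[OF fI, of g] A(1) W cI
    by linarith
  have "a \<le> card U * a" using k length_us by (cases "card U") auto
  moreover have "x \<le> 2 * (p + t + q)" if "x \<le> a + (p + t + q) + t" "a \<le> p" for x p q :: nat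
    using that by (simp add: algebra_simps)
  ultimately have "card ?Y \<le> 2 * \<Omega>" using Y unfolding \<Omega>_def by blast
  moreover have "card ?I * (b - 1) \<le> \<Omega>"
    unfolding \<Omega>_def using cI by (intro trans_le_add2 mult_le_mono) auto
  ultimately have sz: "card ?Y + card ?I * (b - 1) \<le> L" using L by linarith
  have "finite ?Y" using fA W fI by auto
  from select_disjoint[OF fI this sz, of "\<lambda>v F. card F = b - 1 \<and> F \<inter> A = {} \<and> g v \<notin> F \<and>
      (insert (g v) (A \<union> F), g v) \<in> K", OF centre_block[OF st gA(1) A(1)]]
  obtain F where F: "\<forall>v\<in>?I. (card (F v) = b - 1 \<and> F v \<inter> A = {} \<and> g v \<notin> F v \<and>
      (insert (g v) (A \<union> F v), g v) \<in> K) \<and> finite (F v) \<and> card (F v) \<le> b - 1 \<and> F v \<inter> ?Y = {}"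
    and dF: "disjoint_family_on F ?I" by auto
  define \<beta> where "\<beta> v = insert (g v) (F v)" for v
  have "disjoint_family_on \<beta> ?I"
    unfolding disjoint_family_on_def
  proof (intro ballI impI)
    fix v w assume vw: "v \<in> ?I" "w \<in> ?I" "v \<noteq> w"
    have "F v \<inter> F w = {}" using dF vw by (rule disjoint_family_onD)
    moreover have "g v \<noteq> g w" using g(1) vw by (meson inj_onD)
    moreover have "g v \<notin> F w" "g w \<notin> F v" using F vw by blast+
    ultimately show "\<beta> v \<inter> \<beta> w = {}" by (auto simp: \<beta>_def)
  qed
  moreover have "card (\<beta> v) = b \<and> g v \<in> \<beta> v \<and> \<beta> v \<inter> (A \<union> ?W) = {} \<and> centred K A (\<beta> v) (g v)"
    if v: "v \<in> ?I" for v
  proof -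
    from F v have Fv: "card (F v) = b - 1" "g v \<notin> F v" "(insert (g v) (A \<union> F v), g v) \<in> K"
      "finite (F v)" "F v \<inter> ?Y = {}" by blast+
    have "card (\<beta> v) = b" using Fv ab by (simp add: \<beta>_def)
    moreover have "\<beta> v \<inter> (A \<union> ?W) = {}" using Fv(5) gA[OF v] by (auto simp: \<beta>_def)
    ultimately show ?thesis using Fv(3) by (simp add: \<beta>_def centred_def)
  qed
  moreover have "centred K A (\<phi> v) (c v)" if "v \<in> N (us ! k) \<inter> NZ k" for v
    using old[OF that] by (simp add: centred_def)
  ultimately show ?thesis using emb_Suc[OF e k A] by blast
qed

text \<open>No vertex is in use yet, so all of the at least \<open>t\<close> centres of some
  \<open>A\<close> inside a surviving \<open>e - {c}\<close> are available.\<close>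

lemma emb_first:
  assumes st: "stable X K L \<delta>" and L: "3 * \<Omega> \<le> L" and K: "K \<noteq> {}" and us0: "0 < length us"
  shows "\<exists>\<phi> c. emb (centred K) (Suc 0) \<phi> c"
proof -
  obtain e c where ec: "(e, c) \<in> K" using K by auto
  note * = stableD(2)[OF st ec]
  have "card (e - {c}) = a + b - 1" using * by simp
  then have "a \<le> card (e - {c})" using ab by simp
  then obtain A where A: "A \<subseteq> e - {c}" "card A = a" by (meson obtain_subset_with_card_n)
  let ?P = "e - {c}"
  have "?P = A \<union> (?P - A)" using A by auto
  then have "codeg K ?P \<subseteq> cent K A" using codeg_cent[of K A "?P - A"] by simp
  then have "t \<le> card (cent K A)"
    using stableD(3)[OF st ec] card_mono[OF cent_sub(2)[OF st]] by (meson le_trans)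
  then have "card (N (us ! 0) - NZ 0) \<le> card (cent K A)" using card_N_NZ[OF us0] by simp
  then show ?thesis
    by (intro emb_Suc_centres[OF st L emb_0 us0 A(2)]) (auto simp: pre_def NZ_def)
qed

text \<open>Each \<open>F\<close> in \<open>\<F>\<close> has at least \<open>t\<close> centres,
  fewer than \<open>m\<close> of them outside \<open>W\<close>, hence more than \<open>z\<close>
  inside; their trace \<open>\<Theta>\<close> on \<open>W\<close> takes at most
  \<open>2 ^ \<Omega>\<close> values. As \<open>A\<close> has at most \<open>\<Omega> + t\<close>
  centres altogether, the pairs over \<open>A\<close> promised by (iii) involve many different
  \<open>F\<close>. These two losses form the constant.\<close>

lemma FA_pigeonhole:
  assumes st: "stable X K L \<delta>" and "\<delta> > 0" and ex: "(A \<union> B, x) \<in> K" "x \<notin> A" and A: "card A = a"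
    and W: "finite W" "card W \<le> \<Omega>" and few: "card (cent K A - W) < m" and mt: "m + z \<le> t"
  shows "\<exists>\<Theta>\<in>{\<Theta>. \<Theta> \<subseteq> W \<and> z < card \<Theta>}.
    \<delta> / (real (\<Omega> + t) * 2 ^ \<Omega>) * real (card X) ^ (b - 1) \<le> real (card (FA X K \<Theta> A))"
proof -
  let ?n = "real (card X) ^ (b - 1)"
  let ?I = "{\<Theta>. \<Theta> \<subseteq> W \<and> z < card \<Theta>}"
  define \<F> where "\<F> = {F. F \<inter> A = {} \<and> codeg K (A \<union> F) \<noteq> {}}"
  let ?G = "{p\<in>K. A \<subseteq> fst p \<and> snd p \<notin> A}"
  have fX: "finite X" by (rule stableD(1)[OF st])
  have fA: "finite A" using ab A by (intro card_ge_0_finite) auto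
  have eX: "A \<union> B \<subseteq> X" "card (A \<union> B) = a + b" using stableD(2)[OF st ex(1)] by auto
  then have "card X > 0" using fX ab card_mono[of X "A \<union> B"] by linarith
  have F: "F \<subseteq> X \<and> card F = b - 1" if FF: "F \<in> \<F>" for F
  proof -
    obtain y where y: "y \<notin> A \<union> F" "(insert y (A \<union> F), y) \<in> K" and d: "F \<inter> A = {}"
      using FF unfolding \<F>_def codeg_def by blast
    note * = stableD(2)[OF st y(2)]
    have "card (insert y (A \<union> F)) = Suc (card A + card F)"
      using y(1) * d by (subst card_insert_disjoint) (auto intro!: card_Un_disjoint)
    then show ?thesis using * A by auto
  qed
  then have fF: "finite \<F>" using fX by (intro finite_subset[of \<F> "Pow X"]) auto
  have "card (cent K A) \<le> card (cent K A - W) + card (W)"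
    using cent_sub[OF st, of A] W card_mono[of "(cent K A - W) \<union> W" "cent K A"]
      card_Un_le[of "cent K A - W" W] by auto
  then have cc: "card (cent K A) \<le> \<Omega> + t" using few W mt by linarith
  have "?G \<subseteq> (\<lambda>(F, y). (insert y (A \<union> F), y)) ` (\<F> \<times> cent K A)"
  proof
    fix p assume "p \<in> ?G"
    then obtain e y where p: "p = (e, y)" "(e, y) \<in> K" "A \<subseteq> e" "y \<notin> A" by (cases p) auto
    note * = stableD(2)[OF st p(2)]
    let ?F = "e - A - {y}"
    have "insert y (A \<union> ?F) = e" using p * by auto
    moreover from this have "y \<in> codeg K (A \<union> ?F)" using p by (auto simp: codeg_def)
    then have "?F \<in> \<F>" by (auto simp: \<F>_def)
    moreover have "y \<in> cent K A" using p by (auto simp: cent_def)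
    ultimately show "p \<in> (\<lambda>(F, y). (insert y (A \<union> F), y)) ` (\<F> \<times> cent K A)"
      using p by (intro image_eqI[of _ _ "(?F, y)"]) auto
  qed
  then have "card ?G \<le> card (\<F> \<times> cent K A)"
    using fF cent_sub[OF st] by (meson card_image_le card_mono finite_SigmaI finite_imageI le_trans)
  also have "\<dots> \<le> card \<F> * (\<Omega> + t)" using cc by (simp add: card_cartesian_product)
  finally have "real (card ?G) \<le> real (card \<F> * (\<Omega> + t))" by (simp only: of_nat_le_iff)
  moreover have "real (card \<F> * (\<Omega> + t)) = real (card \<F>) * real (\<Omega> + t)" by (rule of_nat_mult)
  moreover have "\<delta> * ?n \<le> real (card ?G)" using ex A by (intro stableD(5)[OF st ex(1)]) auto
  ultimately have cF: "\<delta> * ?n \<le> real (card \<F>) * real (\<Omega> + t)" by linarith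
  have pos: "real (\<Omega> + t) > 0" using t_pos by simp
  have fI: "finite ?I" using W by (auto intro: finite_subset[of _ "Pow W"])
  have "card ?I \<le> card (Pow W)" using W by (intro card_mono) auto
  also have "\<dots> \<le> 2 ^ \<Omega>" using W by (simp add: card_Pow power_increasing)
  finally have cI: "real (card ?I) \<le> 2 ^ \<Omega>" by (metis of_nat_le_iff of_nat_numeral of_nat_power)
  show ?thesis
  proof (rule card_pigeonhole_UN[OF fI cI, where S = \<F>])
    show "0 < \<delta> / (real (\<Omega> + t) * 2 ^ \<Omega>) * ?n" using \<open>\<delta> > 0\<close> pos \<open>card X > 0\<close> by simp
    have "\<delta> / (real (\<Omega> + t) * 2 ^ \<Omega>) * ?n * 2 ^ \<Omega> = \<delta> * ?n / real (\<Omega> + t)"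
      by (simp del: of_nat_add)
    also have "\<dots> \<le> real (card \<F>)" using cF pos by (simp only: pos_divide_le_eq)
    finally show "\<delta> / (real (\<Omega> + t) * 2 ^ \<Omega>) * ?n * 2 ^ \<Omega> \<le> real (card \<F>)" .
    show "\<F> \<subseteq> (\<Union>\<Theta>\<in>?I. FA X K \<Theta> A)"
    proof
      fix F assume F': "F \<in> \<F>"
      define \<Theta> where "\<Theta> = codeg K (A \<union> F) \<inter> W"
      obtain y where "y \<in> codeg K (A \<union> F)" using F' by (auto simp: \<F>_def)
      then have "t \<le> card (codeg K (A \<union> F))" by (rule codeg_card[OF st])
      also have "\<dots> \<le> card (codeg K (A \<union> F) - W) + card \<Theta>"
        unfolding \<Theta>_def by (metis Int_Diff_Un add.commute card_Un_le Int_commute)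
      also have "card (codeg K (A \<union> F) - W) \<le> card (cent K A - W)"
        using cent_sub[OF st, of A] codeg_cent[of K A F] by (intro card_mono) auto
      finally have "z < card \<Theta>" using few mt by linarith
      then have "\<Theta> \<in> ?I" by (auto simp: \<Theta>_def)
      moreover have "F \<in> FA X K \<Theta> A" using F[OF F'] F' by (auto simp: FA_def \<Theta>_def codeg_def \<F>_def)
      ultimately show "F \<in> (\<Union>\<Theta>\<in>?I. FA X K \<Theta> A)" by blast
    qed
  qed (use finite_FA[OF fX] in auto)
qed

text \<open>If all candidates \<open>A\<close> avoiding the copy lack free centres, colour
  \<open>A\<close> by a set \<open>\<Theta>\<close> of used centres that many of its sets
  \<open>F\<close> share; one colour class stays spread. In \<open>L\<close>,
  \<open>2 ^ \<Omega> * \<Lambda>\<close> pays for the colours, one \<open>\<Omega>\<close> for the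
  copy and \<open>3 * \<Omega>\<close> for a successful extension.\<close>

lemma emb_Suc_or_config:
  assumes st: "stable X K L \<delta>" and "\<delta> > 0" and L: "4 * \<Omega> + 2 ^ \<Omega> * \<Lambda> \<le> L"
    and e: "emb (centred K) k \<phi> c" and k: "k < length us" "0 < k"
  shows "(\<exists>\<phi>' c'. emb (centred K) (Suc k) \<phi>' c') \<or>
    (\<exists>\<Theta>. card (NZ k) < card \<Theta> \<and> config X K \<Theta> \<Lambda> (\<delta> / (real (\<Omega> + t) * 2 ^ \<Omega>)))"
proof -
  let ?u = "us ! k"
  let ?W = "\<Union>(\<phi> ` (pre k \<union> NZ k))"
  have W: "finite ?W" "card ?W \<le> \<Omega>" using emb_image[OF e] by auto
  obtain v where v: "N ?u \<inter> NZ k = {v}" using N_uniq[OF k(2,1)] by (auto simp: NZ_def pre_def)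
  then obtain u' where u': "u' \<in> pre k" "v \<in> N u'" by (auto simp: NZ_def)
  have vNZ: "v \<in> NZ k" using v by blast
  have B: "card (\<phi> v) = b" "c v \<in> \<phi> v" "(\<phi> u' \<union> \<phi> v, c v) \<in> K"
    using e u' vNZ by (auto simp: emb_def centred_def)
  have "card (\<phi> u' \<union> \<phi> v) = a + b" using stableD(2)[OF st B(3)] by simp
  then have "\<phi> v \<subset> \<phi> u' \<union> \<phi> v" using B(1) ab by auto
  \<comment> \<open>The embedded block \<open>\<phi> v\<close> has size \<open>b\<close>, so the
    clause for (ii) supplies many sets that form an edge with it and keep the centre
    \<open>c v\<close>.\<close>
  then have sp: "spread L {e' - \<phi> v | e'. (e', c v) \<in> K \<and> \<phi> v \<subseteq> e'}"
    using stableD(4)[OF st B(3,2)] B(1) by blast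
  define \<A> where "\<A> = {A. card A = a \<and> (A \<union> \<phi> v, c v) \<in> K \<and> c v \<notin> A}"
  have spA: "spread L \<A>"
  proof (rule spread_antimono[OF sp le_refl], clarify)
    fix e' assume e': "(e', c v) \<in> K" "\<phi> v \<subseteq> e'"
    have "finite (\<phi> v)" using B ab by (intro card_ge_0_finite) auto
    then have "card (e' - \<phi> v) = a" using stableD(2)[OF st e'(1)] e'(2) B(1)
      by (simp add: card_Diff_subset)
    moreover have "e' - \<phi> v \<union> \<phi> v = e'" using e' by auto
    ultimately show "e' - \<phi> v \<in> \<A>" using e' B by (simp add: \<A>_def)
  qed
  show ?thesis
  proof (cases "\<exists>A\<in>\<A>. A \<inter> ?W = {} \<and> card (N ?u - NZ k) \<le> card (cent K A - ?W)")
    case True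
    then obtain A where "card A = a" "(A \<union> \<phi> v, c v) \<in> K" "A \<inter> ?W = {}"
      "card (N ?u - NZ k) \<le> card (cent K A - ?W)" by (auto simp: \<A>_def)
    then show ?thesis using L v by (intro disjI1 emb_Suc_centres[OF st _ e k(1)]) auto
  next
    case False
    let ?I = "{\<Theta>. \<Theta> \<subseteq> ?W \<and> card (NZ k) < card \<Theta>}"
    let ?\<eta> = "\<delta> / (real (\<Omega> + t) * 2 ^ \<Omega>)"
    have fI: "finite ?I" using W by (auto intro: finite_subset[of _ "Pow ?W"])
    have "card ?I \<le> card (Pow ?W)" using W by (intro card_mono) auto
    also have "\<dots> \<le> 2 ^ \<Omega>" using W by (simp add: card_Pow power_increasing)
    finally have "card ?I * \<Lambda> \<le> 2 ^ \<Omega> * \<Lambda>" by simp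
    then have L': "card ?W + card ?I * \<Lambda> \<le> L" using L W by linarith
    have "\<exists>\<Theta>\<in>?I. spread \<Lambda> {A\<in>\<A>. ?\<eta> * real (card X) ^ (b - 1) \<le> real (card (FA X K \<Theta> A))}"
    proof (rule spread_pigeonhole[OF spA fI W(1) L'])
      fix A assume A: "A \<in> \<A>" "A \<inter> ?W = {}"
      then have "card (cent K A - ?W) < card (N ?u - NZ k)" using False by (meson not_le)
      then show "\<exists>\<Theta>\<in>?I. ?\<eta> * real (card X) ^ (b - 1) \<le> real (card (FA X K \<Theta> A))"
        using A card_N_NZ[OF k(1)]
        by (intro FA_pigeonhole[OF st \<open>\<delta> > 0\<close> _ _ _ W, of A "\<phi> v" "c v"]) (auto simp: \<A>_def)
    qed
    then obtain \<Theta> where \<Theta>: "\<Theta> \<subseteq> ?W" "card (NZ k) < card \<Theta>"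
      and sp\<Theta>: "spread \<Lambda> {A\<in>\<A>. ?\<eta> * real (card X) ^ (b - 1) \<le> real (card (FA X K \<Theta> A))}"
      by auto
    have "spread \<Lambda> {A. card A = a \<and> ?\<eta> * real (card X) ^ (b - 1) \<le> real (card (FA X K \<Theta> A))}"
      by (rule spread_antimono[OF sp\<Theta> le_refl]) (auto simp: \<A>_def)
    moreover have "finite \<Theta>" using \<Theta>(1) W(1) by (rule finite_subset)
    ultimately show ?thesis using \<Theta>(2) unfolding config_def by blast
  qed
qed

section \<open>Configurations of shared centres\<close>

text \<open>Otherwise, for every \<open>A\<close> avoiding \<open>W\<close>, each \<open>F\<close>
  has a further centre in \<open>W - \<Theta>\<close>. Colouring first the sets \<open>F\<close> and
  then the blocks \<open>A\<close> by such a centre yields a configuration for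
  \<open>insert w \<Theta>\<close>, against \<open>no\<close>. The number of colours, at most
  \<open>M\<close>, explains \<open>\<eta> / M\<close> and \<open>M * \<Lambda>'\<close>.\<close>

lemma config_sequence_step:
  fixes \<eta> :: real
  assumes st: "stable X K L \<delta>" and cfg: "config X K \<Theta> \<Lambda> \<eta>" and "\<Theta> \<noteq> {}" and "\<eta> > 0" and X: "0 < card X"
    and M: "0 < M" "M + M * \<Lambda>' \<le> \<Lambda>" and W: "finite W" "card W \<le> M"
    and no: "\<And>w. card \<Theta> < t \<Longrightarrow> w \<notin> \<Theta> \<Longrightarrow> \<not> config X K (insert w \<Theta>) \<Lambda>' (\<eta> / real M)"
  shows "\<exists>A. card A = a \<and> \<eta> * real (card X) ^ (b - 1) \<le> real (card (FA X K \<Theta> A)) \<and> A \<inter> W = {} \<and>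
    t \<le> card \<Theta> + card (cent K A - (\<Theta> \<union> W))"
proof (rule ccontr)
  assume neg: "\<not> ?thesis"
  let ?n = "real (card X) ^ (b - 1)"
  define \<A> where "\<A> = {A. card A = a \<and> \<eta> * ?n \<le> real (card (FA X K \<Theta> A))}"
  have sp: "spread \<Lambda> \<A>" and f\<Theta>: "finite \<Theta>" using cfg by (auto simp: config_def \<A>_def)
  have few: "card \<Theta> + card (cent K A - (\<Theta> \<union> W)) < t" if "A \<in> \<A>" "A \<inter> W = {}" for A
    using neg that by (auto simp: \<A>_def not_le)
  have cI: "card (W - \<Theta>) \<le> M" using W card_mono[of W "W - \<Theta>"] by auto
  then have "card (W - \<Theta>) * \<Lambda>' \<le> M * \<Lambda>'" by simp
  then have \<Lambda>: "card W + card (W - \<Theta>) * \<Lambda>' \<le> \<Lambda>" using M W by linarith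
  have "\<exists>w\<in>W - \<Theta>. spread \<Lambda>' {A\<in>\<A>. \<eta> / real M * ?n \<le> real (card (FA X K (insert w \<Theta>) A))}"
  proof (rule spread_pigeonhole[OF sp _ W(1) \<Lambda>])
    fix A assume A: "A \<in> \<A>" "A \<inter> W = {}"
    show "\<exists>w\<in>W - \<Theta>. \<eta> / real M * ?n \<le> real (card (FA X K (insert w \<Theta>) A))"
    proof (rule card_pigeonhole_UN[where S = "FA X K \<Theta> A" and m = "real M"])
      show "FA X K \<Theta> A \<subseteq> (\<Union>w\<in>W - \<Theta>. FA X K (insert w \<Theta>) A)"
      proof
        fix F assume F: "F \<in> FA X K \<Theta> A"
        obtain x where "x \<in> \<Theta>" using \<open>\<Theta> \<noteq> {}\<close> by auto
        then have "x \<in> codeg K (A \<union> F)" using F by (auto simp: FA_def codeg_def)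
        then have t: "t \<le> card (codeg K (A \<union> F))" by (rule codeg_card[OF st])
        have fc: "finite (codeg K (A \<union> F))"
          using codeg_cent[of K A F] cent_sub(2)[OF st, of A] finite_subset by blast
        have "\<not> codeg K (A \<union> F) \<inter> W \<subseteq> \<Theta>"
        proof
          assume "codeg K (A \<union> F) \<inter> W \<subseteq> \<Theta>"
          then have "codeg K (A \<union> F) \<subseteq> \<Theta> \<union> (cent K A - (\<Theta> \<union> W))"
            using codeg_cent[of K A F] by blast
          then have "card (codeg K (A \<union> F)) \<le> card (\<Theta> \<union> (cent K A - (\<Theta> \<union> W)))"
            using f\<Theta> cent_sub(2)[OF st, of A] by (intro card_mono) auto
          also have "\<dots> \<le> card \<Theta> + card (cent K A - (\<Theta> \<union> W))" by (rule card_Un_le)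
          finally show False using few[OF A] t by linarith
        qed
        then obtain w where w: "w \<in> codeg K (A \<union> F)" "w \<in> W" "w \<notin> \<Theta>" by blast
        then have "F \<in> FA X K (insert w \<Theta>) A" using F by (auto simp: FA_def codeg_def)
        then show "F \<in> (\<Union>w\<in>W - \<Theta>. FA X K (insert w \<Theta>) A)" using w by blast
      qed
      show "\<eta> / real M * ?n * real M \<le> real (card (FA X K \<Theta> A))" using A M by (simp add: \<A>_def)
    qed (use W cI M X \<open>\<eta> > 0\<close> finite_FA stableD(1)[OF st] in auto)
  qed (use W in auto)
  then obtain w where w: "w \<in> W - \<Theta>"
    and spw: "spread \<Lambda>' {A\<in>\<A>. \<eta> / real M * ?n \<le> real (card (FA X K (insert w \<Theta>) A))}" by blast
  have "spread \<Lambda>' {A. card A = a \<and> \<eta> / real M * ?n \<le> real (card (FA X K (insert w \<Theta>) A))}"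
    by (rule spread_antimono[OF spw le_refl]) (auto simp: \<A>_def)
  then have "config X K (insert w \<Theta>) \<Lambda>' (\<eta> / real M)" using f\<Theta> by (simp add: config_def)
  \<comment> \<open>\<open>no\<close> is available only below \<open>t\<close> centres; any
    \<open>A\<close> avoiding \<open>W\<close> gives \<open>card \<Theta> < t\<close> by the strict
    inequality in \<open>few\<close>.\<close>
  moreover have "card W \<le> \<Lambda>" using \<Lambda> by linarith
  then obtain A where "A \<in> \<A>" "A \<inter> W = {}" by (rule spreadD[OF sp W(1)])
  then have "card \<Theta> < t" using few by fastforce
  ultimately show False using no w by blast
qed

text \<open>Each block is chosen with all earlier blocks as \<open>W\<close>, of size at most
  \<open>m * a\<close>. So its additional centres avoid the earlier blocks, but perhaps not the
  later ones.\<close>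

lemma config_sequence:
  fixes \<eta> :: real
  assumes st: "stable X K L \<delta>" and cfg: "config X K \<Theta> \<Lambda> \<eta>" and "\<Theta> \<noteq> {}" and "\<eta> > 0" and X: "0 < card X"
    and M: "0 < m" "m * a + m * a * \<Lambda>' \<le> \<Lambda>"
    and no: "\<And>w. card \<Theta> < t \<Longrightarrow> w \<notin> \<Theta> \<Longrightarrow> \<not> config X K (insert w \<Theta>) \<Lambda>' (\<eta> / real (m * a))"
    and "l \<le> m"
  shows "\<exists>f. \<forall>j<l. card (f j) = a \<and> \<eta> * real (card X) ^ (b - 1) \<le> real (card (FA X K \<Theta> (f j))) \<and>
    f j \<inter> (\<Union>i<j. f i) = {} \<and> t \<le> card \<Theta> + card (cent K (f j) - (\<Theta> \<union> (\<Union>i<j. f i)))"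
  using \<open>l \<le> m\<close>
proof (induction l)
  case 0
  then show ?case by simp
next
  case (Suc l)
  let ?P = "\<lambda>f j. card (f j) = a \<and> \<eta> * real (card X) ^ (b - 1) \<le> real (card (FA X K \<Theta> (f j))) \<and>
    f j \<inter> (\<Union>i<j. f i) = {} \<and> t \<le> card \<Theta> + card (cent K (f j) - (\<Theta> \<union> (\<Union>i<j. f i)))"
  obtain f where f: "\<forall>j<l. ?P f j" using Suc by auto
  let ?W = "\<Union>i<l. f i"
  have ma: "0 < m * a" using M ab by simp
  have "card ?W \<le> (\<Sum>i<l. card (f i))" by (rule card_UN_le) simp
  also have "\<dots> = l * a" using f by simp
  also have "\<dots> \<le> m * a" using Suc.prems by simp
  finally have cW: "card ?W \<le> m * a" .
  have "finite (f i)" if "i < l" for i using f that ab by (intro card_ge_0_finite) auto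
  then have fW: "finite ?W" by auto
  from config_sequence_step[OF st cfg \<open>\<Theta> \<noteq> {}\<close> \<open>\<eta> > 0\<close> X ma M(2) fW cW no]
  obtain A where A: "card A = a" "\<eta> * real (card X) ^ (b - 1) \<le> real (card (FA X K \<Theta> A))"
    "A \<inter> ?W = {}" "t \<le> card \<Theta> + card (cent K A - (\<Theta> \<union> ?W))" by blast
  let ?f = "f(l := A)"
  have eq: "(\<Union>i<j. ?f i) = (\<Union>i<j. f i)" if "j \<le> l" for j using that by auto
  have "?P ?f j" if "j < Suc l" for j
  proof (cases "j = l")
    case True
    show ?thesis unfolding True eq[OF le_refl] fun_upd_same using A by blast
  next
    case False
    then have j: "j < l" using that by simp
    show ?thesis unfolding eq[OF less_imp_le[OF j]] fun_upd_other[OF False] using f j by blast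
  qed
  then show ?case by blast
qed

text \<open>Some \<open>k + 1\<close> of the blocks share a dense family of sets \<open>F\<close>;
  with the centres in \<open>\<Theta>\<close> they carry a complete bipartite blowup, large enough
  for all of \<open>NZ k\<close>. New neighbours of \<open>us ! k\<close> for which
  \<open>\<Theta>\<close> is too small have no neighbour in \<open>pre k\<close>, so a centre of the
  one block assigned to \<open>us ! k\<close> is enough for them.\<close>

lemma emb_of_sequence:
  fixes \<eta> :: real
  assumes st: "stable X K L \<delta>" and L: "3 * \<Omega> \<le> L" and f\<Theta>: "finite \<Theta>" and "\<eta> > 0" and X: "0 < card X"
    and k: "k < length us" and \<Theta>: "card (NZ k) \<le> card \<Theta>"
    and m: "2 * real (Suc k) \<le> real m * \<eta>" and n: "real (3 * \<Omega>) < \<eta> / 2 / 2 ^ m * real (card X)"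
    and f: "\<And>j. j < m \<Longrightarrow> card (f j) = a"
      "\<And>j. j < m \<Longrightarrow> \<eta> * real (card X) ^ (b - 1) \<le> real (card (FA X K \<Theta> (f j)))"
      "\<And>j. j < m \<Longrightarrow> f j \<inter> (\<Union>i<j. f i) = {}"
      "\<And>j. j < m \<Longrightarrow> t \<le> card \<Theta> + card (cent K (f j) - (\<Theta> \<union> (\<Union>i<j. f i)))"
  shows "\<exists>\<phi> c. emb (centred K) (Suc k) \<phi> c"
proof -
  let ?n = "real (card X) ^ (b - 1)"
  let ?u = "us ! k"
  let ?U = "{F. F \<subseteq> X \<and> card F = b - 1}"
  have fX: "finite X" by (rule stableD(1)[OF st])
  have "real (card ?U) \<le> ?n"
    using card_subsets_le_power[OF fX, of "b - 1"] by (metis of_nat_le_iff of_nat_power)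
  moreover have "?n > 0" using X by simp
  moreover have "FA X K \<Theta> (f j) \<subseteq> ?U" for j by (auto simp: FA_def)
  ultimately obtain J where J: "J \<subseteq> {..<m}" "card J = Suc k"
    and dJ: "\<eta> / 2 / 2 ^ m * ?n \<le> real (card (\<Inter>j\<in>J. FA X K \<Theta> (f j)))"
    using dense_intersection[of ?U ?n m "\<lambda>j. FA X K \<Theta> (f j)" \<eta> "Suc k"] f(2) fX m \<open>\<eta> > 0\<close> by auto
  define \<F> where "\<F> = (\<Inter>j\<in>J. FA X K \<Theta> (f j))"
  have fJ: "finite J" using J finite_subset by blast
  have Jne: "J \<noteq> {}" using J by auto
  have \<F>: "F \<subseteq> X \<and> card F = b - 1 \<and> F \<inter> f j = {} \<and> x \<notin> f j \<and> x \<notin> F \<and> (insert x (f j \<union> F), x) \<in> K"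
    if "F \<in> \<F>" "j \<in> J" "x \<in> \<Theta>" for F j x
    using that by (auto simp: \<F>_def FA_def)
  have \<F>U: "F \<subseteq> X \<and> card F = b - 1" if "F \<in> \<F>" for F
    using that Jne by (auto simp: \<F>_def FA_def)
  have sp\<F>: "spread (3 * \<Omega>) \<F>"
    by (rule dense_spread[OF fX dJ[folded \<F>_def] \<F>U n])
  then obtain F0 where F0: "F0 \<in> \<F>" by (rule spreadD[where Y = "{}"]) auto
  have \<Theta>f: "x \<notin> f j" if "x \<in> \<Theta>" "j \<in> J" for x j using \<F>[OF F0 that(2,1)] by blast
  have ff: "finite (f j)" if "j \<in> J" for j using f(1)[of j] J that ab by (intro card_ge_0_finite) auto
  \<comment> \<open>The latest selected block goes to \<open>us ! k\<close>: its additional centres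
    avoid all earlier blocks, and itself by definition of \<open>cent\<close>, hence every block in
    \<open>J\<close>.\<close>
  define top where "top = Max J"
  have top: "top \<in> J" "\<And>j. j \<in> J \<Longrightarrow> j \<le> top" using fJ Jne by (auto simp: top_def)
  have disf: "f i \<inter> f j = {}" if "i \<in> J" "j \<in> J" "i < j" for i j
    using f(3)[of j] J that by fastforce
  have disf': "f i \<inter> f j = {}" if "i \<in> J" "j \<in> J" "i \<noteq> j" for i j
    using disf[OF that(1,2)] disf[OF that(2,1)] that(3) by (cases i j rule: linorder_cases) auto
  have "card (J - {top}) = card (pre k)" using J fJ top k by (simp add: card_pre)
  then obtain \<sigma>0 where \<sigma>0: "bij_betw \<sigma>0 (pre k) (J - {top})"
    using finite_same_card_bij[OF finite_pre] fJ by (metis finite_Diff)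
  define \<sigma> where "\<sigma> = \<sigma>0(?u := top)"
  have \<sigma>_top: "\<sigma> ?u = top" by (simp add: \<sigma>_def)
  have \<sigma>_eq: "\<sigma> u = \<sigma>0 u" if "u \<in> pre k" for u using that us_notin_pre[OF k] by (auto simp: \<sigma>_def)
  have \<sigma>J: "\<sigma> u \<in> J" if "u \<in> pre (Suc k)" for u
    using that \<sigma>0 top(1) \<sigma>_eq \<sigma>_top unfolding pre_Suc[OF k] by (auto simp: bij_betw_def)
  have \<sigma>_ne: "\<sigma> u \<noteq> \<sigma> w" if uw: "u \<in> pre (Suc k)" "w \<in> pre (Suc k)" "u \<noteq> w" for u w
  proof -
    have "\<sigma> u \<noteq> top" if "u \<in> pre k" for u using that \<sigma>0 \<sigma>_eq by (auto simp: bij_betw_def)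
    moreover have "\<sigma> u \<noteq> \<sigma> w" if "u \<in> pre k" "w \<in> pre k"
      using that \<sigma>0 \<sigma>_eq \<open>u \<noteq> w\<close> by (auto simp: bij_betw_def inj_on_def)
    ultimately show ?thesis using uw \<sigma>_top unfolding pre_Suc[OF k] by (metis insertE)
  qed
  let ?I = "NZ (Suc k)"
  let ?C = "cent K (f top) - (\<Theta> \<union> (\<Union>i<top. f i))"
  have NZsub: "NZ k \<subseteq> ?I" by (simp add: NZ_Suc[OF k])
  have "card (NZ k) \<le> min (card \<Theta>) (card ?I)" using \<Theta> card_mono[OF finite_NZ NZsub] by simp
  \<comment> \<open>\<open>V0\<close> contains \<open>NZ k\<close> and uses as much of
    \<open>\<Theta>\<close> as possible, so at most \<open>t - card \<Theta>\<close> vertices are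
    left for the additional centres.\<close>
  then obtain V0 where V0: "NZ k \<subseteq> V0" "V0 \<subseteq> ?I" "card V0 = min (card \<Theta>) (card ?I)"
    using exists_subset_between[OF _ _ NZsub finite_NZ, of "min (card \<Theta>) (card ?I)"] by auto
  have fV0: "finite V0" using V0 finite_NZ finite_subset by blast
  have "card (?I - V0) = card ?I - min (card \<Theta>) (card ?I)"
    using V0 fV0 by (simp add: card_Diff_subset)
  also have "\<dots> \<le> card ?C" using f(4)[of top] top(1) J card_NZ[of "Suc k"] by fastforce
  finally have cV1: "card (?I - V0) \<le> card ?C" .
  obtain h0 where h0: "inj_on h0 V0" "h0 ` V0 \<subseteq> \<Theta>"
    using inj_on_iff_card_le[OF fV0 f\<Theta>] V0(3) by auto
  obtain h1 where h1: "inj_on h1 (?I - V0)" "h1 ` (?I - V0) \<subseteq> ?C"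
    using inj_on_iff_card_le[of "?I - V0" ?C] cV1 finite_NZ[of "Suc k"] cent_sub(2)[OF st] by auto
  define h where "h v = (if v \<in> V0 then h0 v else h1 v)" for v
  have hV0: "h v \<in> \<Theta>" if "v \<in> V0" for v using that h0 by (auto simp: h_def)
  have hV1: "h v \<in> ?C" if "v \<in> ?I - V0" for v using that h1 by (auto simp: h_def)
  have hinj: "h v \<noteq> h w" if vw: "v \<in> ?I" "w \<in> ?I" "v \<noteq> w" for v w
  proof (cases "v \<in> V0 \<longleftrightarrow> w \<in> V0")
    case True
    then show ?thesis using h0(1) h1(1) vw by (auto simp: h_def inj_on_def)
  next
    case False
    then show ?thesis using hV0[of v] hV0[of w] hV1[of v] hV1[of w] vw by auto
  qed
  have hf: "h v \<notin> f j" if v: "v \<in> ?I" and j: "j \<in> J" for v j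
  proof (cases "v \<in> V0")
    case True
    then show ?thesis using \<Theta>f hV0 j by blast
  next
    case False
    then have "h v \<in> ?C" using hV1 v by blast
    then show ?thesis using top(2)[OF j] by (cases "j = top") (auto simp: cent_def)
  qed
  \<comment> \<open>A vertex of \<open>V0\<close> may be adjacent to several blocks and takes its
    set from the common family; the others only have to fit \<open>f top\<close>.\<close>
  let ?P = "\<lambda>v F. card F = b - 1 \<and> (if v \<in> V0 then F \<in> \<F>
    else F \<inter> f top = {} \<and> h v \<notin> F \<and> (insert (h v) (f top \<union> F), h v) \<in> K)"
  have sp: "spread (3 * \<Omega>) {F. ?P v F \<and> finite F \<and> card F \<le> b - 1}" if v: "v \<in> ?I" for v
  proof (cases "v \<in> V0")
    case True
    show ?thesis
      by (rule spread_antimono[OF sp\<F> le_refl]) (use True in \<open>auto dest: \<F>U intro: finite_subset[OF _ fX]\<close>)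
  next
    case False
    then have "h v \<in> cent K (f top)" using hV1 v by blast
    moreover have "card (f top) = a" using f(1) top J by auto
    ultimately show ?thesis
      by (intro spread_antimono[OF centre_block[OF st] L]) (use False in auto)
  qed
  let ?Y = "\<Union>(f ` J) \<union> h ` ?I"
  have "card (\<Union>(f ` J)) \<le> (\<Sum>j\<in>J. card (f j))" by (rule card_UN_le[OF fJ])
  also have "\<dots> = Suc k * a" using f(1) J by (subst sum.cong[OF refl, where h = "\<lambda>_. a"]) auto
  also have "\<dots> \<le> card U * a" using k length_us by (intro mult_right_mono) auto
  finally have "card (\<Union>(f ` J)) \<le> card U * a" .
  moreover have "card (h ` ?I) \<le> t" using card_image_le[OF finite_NZ, of h "Suc k"] card_NZ[of "Suc k"] by linarith
  ultimately have "card ?Y \<le> card U * a + t" using card_Un_le[of "\<Union>(f ` J)" "h ` ?I"] by linarith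
  moreover have "card ?I * (b - 1) \<le> t * b" using card_NZ by (intro mult_le_mono) auto
  ultimately have "card ?Y + card ?I * (b - 1) \<le> \<Omega>" unfolding \<Omega>_def by (rule add_mono)
  then have sz: "card ?Y + card ?I * (b - 1) \<le> 3 * \<Omega>" by linarith
  have fY: "finite ?Y" using fJ ff finite_NZ by auto
  from select_disjoint[OF finite_NZ fY sz, of ?P, OF sp]
  obtain F where F: "\<forall>v\<in>?I. ?P v (F v) \<and> finite (F v) \<and> card (F v) \<le> b - 1 \<and> F v \<inter> ?Y = {}"
    and dF: "disjoint_family_on F ?I" by blast
  have FY: "F v \<inter> f j = {}" "h w \<notin> F v" if "v \<in> ?I" "j \<in> J" "w \<in> ?I" for v w j
    using F that by blast+
  define \<phi> where "\<phi> x = (if x \<in> U then f (\<sigma> x) else insert (h x) (F x))" for x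
  have \<phi>U: "\<phi> u = f (\<sigma> u)" if "u \<in> pre (Suc k)" for u using that pre_sub by (auto simp: \<phi>_def)
  have \<phi>V: "\<phi> v = insert (h v) (F v)" if "v \<in> ?I" for v using that NZ_sub[of "Suc k"] UV by (auto simp: \<phi>_def)
  have dUV: "\<phi> u \<inter> \<phi> v = {}" "\<phi> v \<inter> \<phi> u = {}" if "u \<in> pre (Suc k)" "v \<in> ?I" for u v
    using that \<sigma>J[OF that(1)] FY(1)[OF that(2) _ that(2)] hf[OF that(2)] by (auto simp: \<phi>U \<phi>V)
  have dU: "\<phi> u \<inter> \<phi> w = {}" if "u \<in> pre (Suc k)" "w \<in> pre (Suc k)" "u \<noteq> w" for u w
    using disf'[OF \<sigma>J[OF that(1)] \<sigma>J[OF that(2)] \<sigma>_ne[OF that]] that by (simp add: \<phi>U)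
  have dV: "\<phi> v \<inter> \<phi> w = {}" if "v \<in> ?I" "w \<in> ?I" "v \<noteq> w" for v w
    using hinj[OF that] disjoint_family_onD[OF dF that] FY(2)[OF that(1) top(1) that(2)]
      FY(2)[OF that(2) top(1) that(1)] that by (auto simp: \<phi>V)
  have "disjoint_family_on \<phi> (pre (Suc k) \<union> ?I)"
    unfolding disjoint_family_on_def using dUV dU dV by (intro ballI impI) (elim UnE, simp_all)
  moreover have "card (\<phi> u) = a" if "u \<in> pre (Suc k)" for u
    using that \<sigma>J[OF that] J f(1) by (auto simp: \<phi>U)
  moreover have "card (\<phi> v) = b \<and> h v \<in> \<phi> v" if v: "v \<in> ?I" for v
  proof -
    have "card (F v) = b - 1" "finite (F v)" "h v \<notin> F v" using F v FY(2)[OF v top(1) v] by auto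
    then show ?thesis using ab v by (simp add: \<phi>V)
  qed
  moreover have "(\<phi> u \<union> \<phi> v, h v) \<in> K" if u: "u \<in> pre (Suc k)" and v: "v \<in> N u" for u v
  proof -
    have vI: "v \<in> ?I" using u v by (auto simp: NZ_def)
    have eq: "\<phi> u \<union> \<phi> v = insert (h v) (f (\<sigma> u) \<union> F v)" using u vI by (auto simp: \<phi>U \<phi>V)
    show ?thesis
    proof (cases "v \<in> V0")
      case True
      then have "F v \<in> \<F>" using F vI by auto
      then show ?thesis using \<F>[OF _ \<sigma>J[OF u] hV0[OF True]] eq by simp
    next
      case False
      have "u = ?u"
      proof (rule ccontr)
        assume "u \<noteq> ?u"
        then have "u \<in> pre k" using u by (simp add: pre_Suc[OF k])
        then have "v \<in> V0" using v V0(1) by (auto simp: NZ_def)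
        then show False using False by simp
      qed
      then show ?thesis using F vI False eq \<sigma>_top by auto
    qed
  qed
  ultimately show ?thesis by (intro exI[of _ \<phi>] exI[of _ h]) (simp add: emb_def centred_def)
qed

text \<open>Induction on the number of centres missing to \<open>t\<close>: either a further centre
  can be added at the price of weaker constants, or none can and a sequence of blocks exists. The
  constants for \<open>Suc l\<close> are computed from those for \<open>l\<close>, so all of them
  are fixed before \<open>X\<close>, \<open>K\<close> and \<open>\<Theta>\<close> are given.\<close>

lemma config_emb:
  assumes k: "k < length us" "0 < k" and "\<eta> > 0"
  shows "\<exists>\<Lambda> L n0. \<forall>(X :: 'x set) K \<delta> \<Theta>. t - card \<Theta> \<le> m \<longrightarrow> card (NZ k) \<le> card \<Theta> \<longrightarrow> \<Theta> \<noteq> {} \<longrightarrow>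
    stable X K L \<delta> \<longrightarrow> config X K \<Theta> \<Lambda> \<eta> \<longrightarrow> n0 \<le> card X \<longrightarrow> (\<exists>\<phi> c. emb (centred K) (Suc k) \<phi> c)"
  using \<open>\<eta> > 0\<close>
proof (induction m arbitrary: \<eta>)
  case (0 \<eta>)
  \<comment> \<open>This many blocks suffice for \<open>dense_intersection\<close> with
    \<open>k + 1\<close> in the place of \<open>s\<close>; \<open>n0\<close> then makes the common
    density strong enough for \<open>dense_spread\<close> against \<open>3 * \<Omega>\<close>
    vertices.\<close>
  obtain m :: nat where m: "2 * real (Suc k) / \<eta> < real m" using reals_Archimedean2 by blast
  have m0: "0 < m" using m \<open>\<eta> > 0\<close> by (cases m) (auto simp: divide_less_0_iff)
  have m': "2 * real (Suc k) \<le> real m * \<eta>" using m \<open>\<eta> > 0\<close> by (simp add: field_simps)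
  obtain n0 :: nat where n0: "real (3 * \<Omega>) / (\<eta> / 2 / 2 ^ m) < real n0" using reals_Archimedean2 by blast
  show ?case
  proof (rule exI[of _ "m * a"], rule exI[of _ "3 * \<Omega>"], rule exI[of _ "Suc n0"], intro allI impI)
    fix X \<Theta> :: "'x set" and K \<delta>
    assume \<Theta>: "t - card \<Theta> \<le> 0" "card (NZ k) \<le> card \<Theta>" "\<Theta> \<noteq> {}" and st: "stable X K (3 * \<Omega>) \<delta>"
      and cfg: "config X K \<Theta> (m * a) \<eta>" and n: "Suc n0 \<le> card X"
    have "real n0 \<le> real (card X)" using n by simp
    then have "real (3 * \<Omega>) / (\<eta> / 2 / 2 ^ m) < real (card X)" using n0 by linarith
    then have n': "real (3 * \<Omega>) < \<eta> / 2 / 2 ^ m * real (card X)"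
      using \<open>\<eta> > 0\<close> by (simp add: field_simps)
    \<comment> \<open>Here \<open>\<Theta>\<close> already has \<open>t\<close> elements, so
      enlarging it is never at issue and \<open>\<Lambda>' = 0\<close> will do.\<close>
    obtain f where "\<forall>j<m. card (f j) = a \<and> \<eta> * real (card X) ^ (b - 1) \<le> real (card (FA X K \<Theta> (f j))) \<and>
      f j \<inter> (\<Union>i<j. f i) = {} \<and> t \<le> card \<Theta> + card (cent K (f j) - (\<Theta> \<union> (\<Union>i<j. f i)))"
      using config_sequence[OF st cfg \<Theta>(3) \<open>\<eta> > 0\<close> _ m0, of 0 m] n \<Theta>(1) by auto
    then show "\<exists>\<phi> c. emb (centred K) (Suc k) \<phi> c"
      using n cfg by (intro emb_of_sequence[OF st le_refl _ \<open>\<eta> > 0\<close> _ k(1) \<Theta>(2) m' n', of f])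
        (auto simp: config_def)
  qed
next
  case (Suc l \<eta>)
  obtain m :: nat where m: "2 * real (Suc k) / \<eta> < real m" using reals_Archimedean2 by blast
  have m0: "0 < m" using m \<open>\<eta> > 0\<close> by (cases m) (auto simp: divide_less_0_iff)
  have m': "2 * real (Suc k) \<le> real m * \<eta>" using m \<open>\<eta> > 0\<close> by (simp add: field_simps)
  obtain n0 :: nat where n0: "real (3 * \<Omega>) / (\<eta> / 2 / 2 ^ m) < real n0" using reals_Archimedean2 by blast
  have "\<eta> / real (m * a) > 0" using \<open>\<eta> > 0\<close> m0 ab by simp
  from Suc.IH[OF this] obtain \<Lambda>' L' n' where IH:
    "\<And>(X :: 'x set) K \<delta> \<Theta>. t - card \<Theta> \<le> l \<Longrightarrow> card (NZ k) \<le> card \<Theta> \<Longrightarrow> \<Theta> \<noteq> {} \<Longrightarrow>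
    stable X K L' \<delta> \<Longrightarrow> config X K \<Theta> \<Lambda>' (\<eta> / real (m * a)) \<Longrightarrow> n' \<le> card X \<Longrightarrow>
    (\<exists>\<phi> c. emb (centred K) (Suc k) \<phi> c)" by metis
  show ?case
  proof (rule exI[of _ "m * a + m * a * \<Lambda>'"], rule exI[of _ "3 * \<Omega> + L'"], rule exI[of _ "Suc n0 + n'"], intro allI impI)
    fix X \<Theta> :: "'x set" and K \<delta>
    assume \<Theta>: "t - card \<Theta> \<le> Suc l" "card (NZ k) \<le> card \<Theta>" "\<Theta> \<noteq> {}"
      and st: "stable X K (3 * \<Omega> + L') \<delta>"
      and cfg: "config X K \<Theta> (m * a + m * a * \<Lambda>') \<eta>" and n: "Suc n0 + n' \<le> card X"
    have "real n0 \<le> real (card X)" using n by simp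
    then have "real (3 * \<Omega>) / (\<eta> / 2 / 2 ^ m) < real (card X)" using n0 by linarith
    then have nX: "real (3 * \<Omega>) < \<eta> / 2 / 2 ^ m * real (card X)"
      using \<open>\<eta> > 0\<close> by (simp add: field_simps)
    have f\<Theta>: "finite \<Theta>" using cfg by (simp add: config_def)
    show "\<exists>\<phi> c. emb (centred K) (Suc k) \<phi> c"
    proof (cases "\<exists>w. card \<Theta> < t \<and> w \<notin> \<Theta> \<and> config X K (insert w \<Theta>) \<Lambda>' (\<eta> / real (m * a))")
      case True
      then obtain w where w: "card \<Theta> < t" "w \<notin> \<Theta>" "config X K (insert w \<Theta>) \<Lambda>' (\<eta> / real (m * a))"
        by blast
      have st': "stable X K L' \<delta>" by (rule stable_antimono[OF st]) simp
      have "card (insert w \<Theta>) = Suc (card \<Theta>)" using w f\<Theta> by simp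
      then show ?thesis using \<Theta> n by (intro IH[OF _ _ _ st' w(3)]) auto
    next
      case False
      then have no: "\<not> config X K (insert w \<Theta>) \<Lambda>' (\<eta> / real (m * a))" if "card \<Theta> < t" "w \<notin> \<Theta>" for w
        using that by blast
      have "0 < card X" using n by linarith
      from config_sequence[OF st cfg \<Theta>(3) Suc.prems this m0 le_refl no le_refl]
      obtain f where "\<forall>j<m. card (f j) = a \<and>
        \<eta> * real (card X) ^ (b - 1) \<le> real (card (FA X K \<Theta> (f j))) \<and>
        f j \<inter> (\<Union>i<j. f i) = {} \<and> t \<le> card \<Theta> + card (cent K (f j) - (\<Theta> \<union> (\<Union>i<j. f i)))"
        by blast
      then show ?thesis
        using n f\<Theta> by (intro emb_of_sequence[OF st _ _ Suc.prems _ k(1) \<Theta>(2) m' nX, of f]) auto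
    qed
  qed
qed

text \<open>When an extension fails, the copy obtained so far is discarded: the configuration it
  leaves behind has more than \<open>card (NZ k)\<close> centres and yields a new copy of the first
  \<open>k + 1\<close> blocks with their neighbours.\<close>

lemma stable_emb_aux:
  assumes "\<delta> > 0" and "0 < k" "k \<le> length us"
  shows "\<exists>L n0. \<forall>(X :: 'x set) K. stable X K L \<delta> \<longrightarrow> K \<noteq> {} \<longrightarrow> n0 \<le> card X \<longrightarrow>
    (\<exists>\<phi> c. emb (centred K) k \<phi> c)"
  using assms(2,3)
proof (induction k rule: nat_induct_non_zero)
  case 1
  then have "0 < length us" by linarith
  then show ?case
    unfolding One_nat_def using emb_first[OF _ le_refl] by blast
next
  case (Suc k)
  then have k: "k < length us" by simp
  obtain L n0 where IH: "\<And>(X :: 'x set) K. stable X K L \<delta> \<Longrightarrow> K \<noteq> {} \<Longrightarrow> n0 \<le> card X \<Longrightarrow>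
    (\<exists>\<phi> c. emb (centred K) k \<phi> c)" using Suc.IH[OF less_imp_le[OF k]] by blast
  let ?\<eta> = "\<delta> / (real (\<Omega> + t) * 2 ^ \<Omega>)"
  have "?\<eta> > 0" using assms t_pos by simp
  from config_emb[OF k Suc.hyps this, of t] obtain \<Lambda> L' n0' where C:
    "\<And>(X :: 'x set) K \<delta> \<Theta>. t - card \<Theta> \<le> t \<Longrightarrow> card (NZ k) \<le> card \<Theta> \<Longrightarrow> \<Theta> \<noteq> {} \<Longrightarrow>
    stable X K L' \<delta> \<Longrightarrow> config X K \<Theta> \<Lambda> ?\<eta> \<Longrightarrow> n0' \<le> card X \<Longrightarrow>
    (\<exists>\<phi> c. emb (centred K) (Suc k) \<phi> c)" by metis
  let ?L = "L + L' + (4 * \<Omega> + 2 ^ \<Omega> * \<Lambda>)"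
  show ?case
  proof (rule exI[of _ ?L], rule exI[of _ "n0 + n0'"], intro allI impI)
    fix X :: "'x set" and K
    assume st: "stable X K ?L \<delta>" and "K \<noteq> {}" and n: "n0 + n0' \<le> card X"
    have s1: "stable X K L \<delta>" and s2: "stable X K L' \<delta>" by (rule stable_antimono[OF st]; simp)+
    obtain \<phi> c where e: "emb (centred K) k \<phi> c" using IH[OF s1 \<open>K \<noteq> {}\<close>] n by auto
    from emb_Suc_or_config[OF st assms(1) _ e k Suc.hyps, of \<Lambda>]
    consider "\<exists>\<phi>' c'. emb (centred K) (Suc k) \<phi>' c'"
      | \<Theta> where "card (NZ k) < card \<Theta>" "config X K \<Theta> \<Lambda> ?\<eta>" by auto
    then show "\<exists>\<phi> c. emb (centred K) (Suc k) \<phi> c"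
    proof cases
      case (2 \<Theta>)
      then have "\<Theta> \<noteq> {}" by auto
      then show ?thesis using 2 n by (intro C[OF _ _ _ s2]) auto
    qed
  qed
qed

end

section \<open>Counting\<close>

lemma card_UN_mult:
  assumes "finite I" "card I \<le> m" "\<And>i. i \<in> I \<Longrightarrow> card (T i) \<le> k"
  shows "card (\<Union>i\<in>I. T i) \<le> m * k"
proof -
  have "card (\<Union>i\<in>I. T i) \<le> (\<Sum>i\<in>I. card (T i))" by (rule card_UN_le[OF assms(1)])
  also have "\<dots> \<le> (\<Sum>i\<in>I. k)" by (intro sum_mono assms(3))
  also have "\<dots> \<le> m * k" using assms(2) by simp
  finally show ?thesis .
qed

text \<open>Such an edge is recovered from \<open>Q = e - {x, y}\<close>: \<open>x\<close> lies in
  the bounded set \<open>G Q\<close>, and then \<open>y\<close> in the bounded set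
  \<open>G (insert x Q)\<close>.\<close>

lemma card_generated_edges:
  fixes C :: "'x set \<Rightarrow> 'x set"
  assumes X: "finite X" and C: "\<And>S. finite S \<Longrightarrow> card S < r \<Longrightarrow> finite (C S) \<and> card (C S) \<le> M" and "2 \<le> r"
  shows "card {e. e \<subseteq> X \<and> card e = r \<and> (\<exists>x y S S'. x \<in> e \<and> y \<in> e \<and> x \<noteq> y \<and>
      S \<subseteq> e - {x, y} \<and> S' \<subseteq> e - {y} \<and> x \<in> C S \<and> y \<in> C S')} \<le> card X ^ (r - 2) * ((2 ^ r * M) * (2 ^ r * M))"
    (is "card ?D \<le> _")
proof -
  define G where "G Q = (\<Union>S\<in>Pow Q. C S)" for Q
  have G: "finite (G Q)" "card (G Q) \<le> 2 ^ r * M" if Q: "finite Q" "card Q < r" for Q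
  proof -
    have fin: "finite S" "card S < r" if "S \<in> Pow Q" for S
      using that Q finite_subset card_mono[of Q S] by auto
    then show "finite (G Q)" using C Q by (auto simp: G_def)
    have "card (Pow Q) \<le> 2 ^ r" using Q by (simp add: card_Pow)
    then show "card (G Q) \<le> 2 ^ r * M"
      unfolding G_def using C fin Q by (intro card_UN_mult) simp_all
  qed
  let ?I = "{Q. Q \<subseteq> X \<and> card Q = r - 2}"
  let ?T = "\<lambda>Q. \<Union>x\<in>G Q. \<Union>y\<in>G (insert x Q). {insert y (insert x Q)}"
  have fQ: "finite Q" if "Q \<in> ?I" for Q using that X finite_subset by blast
  have c1: "card (insert x Q) < r" if "Q \<in> ?I" for x Q
  proof -
    have "card (insert x Q) \<le> Suc (card Q)" using fQ[OF that] by (simp add: card_insert_if)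
    then show ?thesis using that \<open>2 \<le> r\<close> by simp
  qed
  have c0: "card Q < r" if "Q \<in> ?I" for Q using that \<open>2 \<le> r\<close> by simp
  have g1: "finite (G (insert x Q))" "card (G (insert x Q)) \<le> 2 ^ r * M" if "Q \<in> ?I" for x Q
    using G[of "insert x Q"] fQ[OF that] c1[OF that] by blast+
  have fT: "finite (?T Q)" if "Q \<in> ?I" for Q
    using G(1)[OF fQ[OF that] c0[OF that]] g1(1)[OF that] by (intro finite_UN_I) blast+
  have "?D \<subseteq> (\<Union>Q\<in>?I. ?T Q)"
  proof
    fix e assume "e \<in> ?D"
    then obtain x y S S' where e: "e \<subseteq> X" "card e = r" "x \<in> e" "y \<in> e" "x \<noteq> y"
      "S \<subseteq> e - {x, y}" "S' \<subseteq> e - {y}" "x \<in> C S" "y \<in> C S'" by blast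
    let ?Q = "e - {x, y}"
    have "finite e" using e(1) X finite_subset by blast
    then have "?Q \<in> ?I" using e by (auto simp: card_Diff_subset)
    moreover have "x \<in> G ?Q" using e by (auto simp: G_def)
    moreover have i: "insert x ?Q = e - {y}" using e by auto
    then have "y \<in> G (insert x ?Q)" using e by (auto simp: G_def)
    moreover have "e = insert y (insert x ?Q)" using e by auto
    ultimately show "e \<in> (\<Union>Q\<in>?I. ?T Q)" by blast
  qed
  then have "card ?D \<le> card (\<Union>Q\<in>?I. ?T Q)" using X fT by (intro card_mono) auto
  also have "\<dots> \<le> card X ^ (r - 2) * ((2 ^ r * M) * (2 ^ r * M))"
  proof (rule card_UN_mult)
    show "finite ?I" using X by simp
    show "card ?I \<le> card X ^ (r - 2)" by (rule card_subsets_le_power[OF X])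
    fix Q assume Q: "Q \<in> ?I"
    show "card (?T Q) \<le> (2 ^ r * M) * (2 ^ r * M)"
    proof (rule card_UN_mult[OF G[OF fQ[OF Q] c0[OF Q]]])
      fix x
      have "card (\<Union>y\<in>G (insert x Q). {insert y (insert x Q)}) \<le> 2 ^ r * M * 1"
        by (rule card_UN_mult[OF g1[OF Q]]) simp
      then show "card (\<Union>y\<in>G (insert x Q). {insert y (insert x Q)}) \<le> 2 ^ r * M" by simp
    qed
  qed
  finally show ?thesis .
qed

text \<open>Call \<open>Z \<subseteq> e\<close> closed if \<open>C S \<inter> e \<subseteq> Z\<close> for all \<open>S \<subseteq> Z\<close>. If \<open>e\<close> is not generated by all but two of
  its vertices, then for \<open>x \<noteq> y\<close> in \<open>e\<close> one of \<open>e - {x}\<close>, \<open>e - {y}\<close>, \<open>e - {x, y}\<close> is closed. Closed sets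
  are stable under intersection, so with \<open>M = {x \<in> e. e - {x} is not closed}\<close> every \<open>S \<subseteq> e\<close> for
  which \<open>M - S\<close> is not a singleton is closed.\<close>

lemma generated_edge:
  fixes C :: "'x set \<Rightarrow> 'x set"
  assumes e: "card e = a + b" and ab: "0 < b" "b < a"
    and centre: "\<And>c. c \<in> e \<Longrightarrow> \<exists>S. c \<in> S \<and> S \<subset> e \<and> (card S = b \<or> card S = a + 1) \<and> C S \<inter> (e - S) \<noteq> {}"
    and split: "\<And>A B. A \<union> B = e \<Longrightarrow> A \<inter> B = {} \<Longrightarrow> card A = a \<Longrightarrow> card B = b \<Longrightarrow> C A \<inter> B \<noteq> {} \<or> C B \<inter> A \<noteq> {}"
  shows "\<exists>x y S S'. x \<in> e \<and> y \<in> e \<and> x \<noteq> y \<and> S \<subseteq> e - {x, y} \<and> S' \<subseteq> e - {y} \<and> x \<in> C S \<and> y \<in> C S'"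
proof (rule ccontr)
  assume neg: "\<not> ?thesis"
  have fe: "finite e" using e ab by (intro card_ge_0_finite) simp
  define closed where "closed Z \<longleftrightarrow> (\<forall>S\<subseteq>Z. C S \<inter> e \<subseteq> Z)" for Z
  define M where "M = {x\<in>e. \<not> closed (e - {x})}"
  \<comment> \<open>Otherwise \<open>e - {x, y}\<close> generates one of \<open>x\<close>,
    \<open>y\<close>; the other is generated by the rest of \<open>e\<close>, since it belongs to
    \<open>M\<close>.\<close>
  have pair: "closed (e - {x, y})" if xy: "x \<in> M" "y \<in> M" "x \<noteq> y" for x y
  proof (rule ccontr)
    assume "\<not> closed (e - {x, y})"
    then obtain S z where S: "S \<subseteq> e - {x, y}" "z \<in> C S" "z = x \<or> z = y" by (auto simp: closed_def)
    obtain S1 where S1: "S1 \<subseteq> e - {x}" "x \<in> C S1" using xy(1) by (auto simp: M_def closed_def)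
    obtain S2 where S2: "S2 \<subseteq> e - {y}" "y \<in> C S2" using xy(2) by (auto simp: M_def closed_def)
    have xe: "x \<in> e" "y \<in> e" using xy by (auto simp: M_def)
    from S(3) show False
    proof
      assume "z = x"
      then show False using neg S S2 xe xy(3) by blast
    next
      assume "z = y"
      moreover have "S \<subseteq> e - {y, x}" using S(1) by blast
      ultimately show False using neg S(2) S1 xe xy(3) by metis
    qed
  qed
  have cl: "C S \<inter> (e - S) = {}" if S: "S \<subseteq> e" "card (M - S) \<noteq> 1" for S
  proof (rule ccontr)
    assume "C S \<inter> (e - S) \<noteq> {}"
    then obtain z where z: "z \<in> C S" "z \<in> e" "z \<notin> S" by auto
    have zM: "z \<in> M"
    proof (rule ccontr)
      assume "z \<notin> M"
      then have "closed (e - {z})" using z by (auto simp: M_def)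
      moreover have "S \<subseteq> e - {z}" using S z by auto
      ultimately show False using z unfolding closed_def by blast
    qed
    have "M - S \<noteq> {z}" using S(2) by auto
    then obtain y where y: "y \<in> M" "y \<notin> S" "y \<noteq> z" using z zM by blast
    then have "closed (e - {z, y})" using pair zM by auto
    moreover have "S \<subseteq> e - {z, y}" using S z y by auto
    ultimately show False using z unfolding closed_def by blast
  qed
  have Me: "M \<subseteq> e" by (auto simp: M_def)
  have fM: "finite M" using Me fe finite_subset by blast
  \<comment> \<open>Every \<open>S\<close> containing such a \<open>c\<close> would have
    \<open>M - S\<close> empty and be inert, against \<open>centre\<close>.\<close>
  have "\<not> (\<exists>c\<in>e. M \<subseteq> {c})"
  proof
    assume "\<exists>c\<in>e. M \<subseteq> {c}"
    then obtain c S where "M \<subseteq> {c}" "c \<in> S" "S \<subset> e" "C S \<inter> (e - S) \<noteq> {}" using centre by metis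
    moreover from this have "M - S = {}" by auto
    ultimately show False using cl[of S] by simp
  qed
  moreover have "e \<noteq> {}" using e ab by auto
  ultimately have M2: "2 \<le> card M"
    using Me fM by (cases "card M" rule: nat.exhaust)
      (auto simp: card_Suc_eq numeral_2_eq_2 Suc_le_eq intro!: gr0I)
  \<comment> \<open>For \<open>B\<close> and its complement the sets to look at are
    \<open>M - B\<close> and \<open>M \<inter> B\<close>. If neither is a singleton, both parts are
    inert, against \<open>split\<close>; it remains to find such a \<open>B\<close>.\<close>
  have noB: False if B: "B \<subseteq> e" "card B = b" "card (M \<inter> B) \<noteq> 1" "card (M - B) \<noteq> 1" for B
  proof -
    have fB: "finite B" using B fe finite_subset by blast
    have "M - (e - B) = M \<inter> B" using Me by auto
    then have "C (e - B) \<inter> B = {}" using cl[of "e - B"] B by (auto simp: double_diff)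
    moreover have "C B \<inter> (e - B) = {}" using cl[of B] B by auto
    moreover have "card (e - B) = a" using B e fB by (simp add: card_Diff_subset)
    moreover have "(e - B) \<union> B = e" "(e - B) \<inter> B = {}" using B by auto
    ultimately show False using split[of "e - B" B] B by blast
  qed
  show False
  proof (cases "b \<le> card (e - M)")
    case True
    then obtain B where B: "B \<subseteq> e - M" "card B = b" by (meson obtain_subset_with_card_n)
    then have "M \<inter> B = {}" "M - B = M" by auto
    then show False using noB[of B] B M2 by auto
  next
    case False
    have "card (e - M) = a + b - card M" using e fM Me by (simp add: card_Diff_subset)
    then have Ma: "a < card M" using False by linarith
    \<comment> \<open>For \<open>b = 1\<close> a subset \<open>B\<close> of \<open>M\<close> would
      meet it in a singleton. But then \<open>M = e\<close>, and since \<open>a + 1\<close> is the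
      size of \<open>e\<close>, \<open>centre\<close> yields a singleton \<open>S\<close> with
      \<open>card (M - S) = a > 1\<close>.\<close>
    show False
    proof (cases "b = 1")
      case True
      have "card (e - M) = 0" using False True by linarith
      then have "M = e" using Me fe by auto
      obtain c where c: "c \<in> e" using \<open>e \<noteq> {}\<close> by auto
      obtain S where S: "c \<in> S" "S \<subset> e" "card S = b \<or> card S = a + 1" "C S \<inter> (e - S) \<noteq> {}"
        using centre[OF c] by (elim exE conjE)
      have "card S < card e" using S fe by (simp add: psubset_card_mono)
      then have "card S = 1" using S True e by auto
      moreover have "finite S" using S fe finite_subset by blast
      ultimately have "card (M - S) = a" using \<open>M = e\<close> S e True by (simp add: card_Diff_subset)
      then show False using cl[of S] S ab True by auto
    next
      case b: False
      have "b \<le> card M" using Ma ab by simp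
      then obtain B where B: "B \<subseteq> M" "card B = b" by (meson obtain_subset_with_card_n)
      have "finite B" using B fM finite_subset by blast
      then have "card (M - B) = card M - b" using B by (simp add: card_Diff_subset)
      \<comment> \<open>Here \<open>b < a\<close> enters: \<open>card M \<ge> a + 1\<close> leaves
        at least two elements of \<open>M\<close> outside \<open>B\<close>.\<close>
      then have "card (M - B) \<noteq> 1" using Ma ab by linarith
      moreover have "M \<inter> B = B" using B by auto
      ultimately show False using noB[of B] B Me b by auto
    qed
  qed
qed

text \<open>The constructors stand for the rules (i), (ii) and (iii), in this order.\<close>

datatype 'x elim_key = Codeg "'x set" | Kernel "'x set" 'x | Dense "'x set"

context blowup_tree
begin

text \<open>The size conditions sit in the groups, so keys of the wrong shape have an empty group
  and never fire.\<close>

fun key_group :: "'x elim_key \<Rightarrow> ('x set \<times> 'x) set" where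
  "key_group (Codeg P) = {(e, c). e - {c} = P}"
| "key_group (Kernel S c) = {(e, c'). c' = c \<and> c \<in> S \<and> S \<subset> e \<and> (card S = b \<or> card S = a + 1)}"
| "key_group (Dense A) = {(e, c). A \<subseteq> e \<and> c \<notin> A \<and> card A = a}"

fun key_good :: "nat \<Rightarrow> real \<Rightarrow> 'x elim_key \<Rightarrow> ('x set \<times> 'x) set \<Rightarrow> bool" where
  "key_good L d (Codeg P) G \<longleftrightarrow> t \<le> card G"
| "key_good L d (Kernel S c) G \<longleftrightarrow> spread L ((\<lambda>(e, c'). e - S) ` G)"
| "key_good L d (Dense A) G \<longleftrightarrow> d \<le> real (card G)"

lemma stable_of_elimination:
  assumes X: "finite X" and H: "\<And>e. e \<in> H \<Longrightarrow> e \<subseteq> X \<and> card e = a + b"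
    and K: "K \<subseteq> {(e, c). e \<in> H \<and> c \<in> e}"
    and good: "\<And>\<kappa>. K \<inter> key_group \<kappa> = {} \<or>
      key_good L (\<delta> * real (card X) ^ (b - 1)) \<kappa> (K \<inter> key_group \<kappa>)"
  shows "stable X K L \<delta>"
  unfolding stable_def
proof (intro conjI allI impI)
  fix e c assume ec: "(e, c) \<in> K"
  then have e: "e \<subseteq> X" "card e = a + b" "c \<in> e" using K H by auto
  show "e \<subseteq> X" "card e = a + b" "c \<in> e" by fact+
  have "K \<inter> key_group (Codeg (e - {c})) \<noteq> {}" using ec by auto
  then have "t \<le> card (K \<inter> key_group (Codeg (e - {c})))" using good[of "Codeg (e - {c})"] by simp
  also have "K \<inter> key_group (Codeg (e - {c})) = (\<lambda>x. (insert x (e - {c}), x)) ` codeg K (e - {c})"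
  proof (intro equalityI subsetI)
    fix p assume p: "p \<in> K \<inter> key_group (Codeg (e - {c}))"
    then obtain f x where fx: "p = (f, x)" "(f, x) \<in> K" "f - {x} = e - {c}" by auto
    moreover have "x \<in> f" using fx K by auto
    ultimately have "f = insert x (e - {c})" "x \<notin> e - {c}" by auto
    then show "p \<in> (\<lambda>x. (insert x (e - {c}), x)) ` codeg K (e - {c})"
      using fx by (auto simp: codeg_def)
  qed (auto simp: codeg_def)
  also have "card \<dots> = card (codeg K (e - {c}))" by (intro card_image) (auto simp: inj_on_def)
  finally show "t \<le> card (codeg K (e - {c}))" .
  {
    fix S assume S: "c \<in> S" "S \<subset> e" "card S = b \<or> card S = a + 1"
    then have "K \<inter> key_group (Kernel S c) \<noteq> {}" using ec by auto
    then have sp: "spread L ((\<lambda>(e, c'). e - S) ` (K \<inter> key_group (Kernel S c)))"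
      using good[of "Kernel S c"] by simp
    show "spread L {e' - S | e'. (e', c) \<in> K \<and> S \<subseteq> e'}"
      by (rule spread_antimono[OF sp le_refl]) auto
  }
  fix A assume A: "A \<subseteq> e" "c \<notin> A" "card A = a"
  then have "K \<inter> key_group (Dense A) \<noteq> {}" using ec by auto
  moreover have "K \<inter> key_group (Dense A) = {p\<in>K. A \<subseteq> fst p \<and> snd p \<notin> A}" using A by auto
  ultimately show "\<delta> * real (card X) ^ (b - 1) \<le> real (card {p\<in>K. A \<subseteq> fst p \<and> snd p \<notin> A})"
    using good[of "Dense A"] by (simp only: key_good.simps simp_thms)
qed (rule X)

text \<open>The same elimination, with splits as objects and either part as key. Survivors would be
  embedded by \<open>emb_greedy\<close>, so every split is deleted, and the transversals responsible
  for the deletions serve as \<open>C1 A\<close> and \<open>C2 B\<close>.\<close>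

lemma split_covers:
  fixes X :: "'x set"
  assumes "0 < length us" and X: "finite X" and H: "\<And>e. e \<in> H \<Longrightarrow> e \<subseteq> X"
    and noemb: "\<And>\<phi> c K. (\<And>A B. (A, B) \<in> K \<Longrightarrow> A \<union> B \<in> H) \<Longrightarrow> \<not> emb (\<lambda>A B x. (A, B) \<in> K) (length us) \<phi> c"
  shows "\<exists>C1 C2. (\<forall>S. finite (C1 S) \<and> card (C1 S) \<le> 3 * \<Omega> \<and> finite (C2 S) \<and> card (C2 S) \<le> 3 * \<Omega>) \<and>
    (\<forall>A B. A \<union> B \<in> H \<longrightarrow> A \<inter> B = {} \<longrightarrow> card A = a \<longrightarrow> card B = b \<longrightarrow> C1 A \<inter> B \<noteq> {} \<or> C2 B \<inter> A \<noteq> {})"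
proof -
  define K0 where "K0 = {(A, B). A \<union> B \<in> H \<and> A \<inter> B = {} \<and> card A = a \<and> card B = b}"
  define \<Gamma> :: "'x set + 'x set \<Rightarrow> ('x set \<times> 'x set) set" where
    "\<Gamma> \<kappa> = (case \<kappa> of Inl A \<Rightarrow> {p. fst p = A} | Inr B \<Rightarrow> {p. snd p = B})" for \<kappa>
  define Good :: "'x set + 'x set \<Rightarrow> ('x set \<times> 'x set) set \<Rightarrow> bool" where
    "Good \<kappa> G = (case \<kappa> of Inl A \<Rightarrow> spread (3 * \<Omega>) (snd ` G) | Inr B \<Rightarrow> spread (3 * \<Omega>) (fst ` G))" for \<kappa> G
  have "K0 \<subseteq> Pow X \<times> Pow X" using H by (auto simp: K0_def)
  then have fK0: "finite K0" using X finite_subset by blast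
  obtain K' R where K': "K' \<subseteq> K0"
    and good0: "\<forall>\<kappa>. K' \<inter> \<Gamma> \<kappa> = {} \<or> Good \<kappa> (K' \<inter> \<Gamma> \<kappa>)"
    and R0: "\<forall>\<kappa>. R \<kappa> \<subseteq> K0 \<inter> \<Gamma> \<kappa> \<and> (R \<kappa> = {} \<or> \<not> Good \<kappa> (R \<kappa>))"
    and K0: "K0 = K' \<union> (\<Union>\<kappa>. R \<kappa>)"
    using elimination[OF fK0, of \<Gamma> "Good"] by (elim exE conjE)
  have good: "K' \<inter> \<Gamma> \<kappa> = {} \<or> Good \<kappa> (K' \<inter> \<Gamma> \<kappa>)" for \<kappa>
    using good0 by (rule spec)
  have R: "R \<kappa> \<subseteq> K0 \<inter> \<Gamma> \<kappa>" "R \<kappa> = {} \<or> \<not> Good \<kappa> (R \<kappa>)" for \<kappa>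
    using R0[rule_format, of \<kappa>] by - (erule conjE, assumption)+
  have disj: "A \<inter> B = {}" if "(A, B) \<in> K'" for A B
    using subsetD[OF K' that] by (simp add: K0_def)
  have "K' = {}"
  proof (rule ccontr)
    assume ne: "K' \<noteq> {}"
    have "\<exists>\<phi> c. emb (\<lambda>A B x. (A, B) \<in> K') (length us) \<phi> c"
    proof (rule emb_greedy[OF ne _ _ _ le_refl])
      fix A B assume AB: "(A, B) \<in> K'"
      show "card A = a \<and> card B = b" using AB K' by (auto simp: K0_def)
      have "K' \<inter> \<Gamma> (Inl A) \<noteq> {}" using AB by (auto simp: \<Gamma>_def)
      then have sp: "spread (3 * \<Omega>) (snd ` (K' \<inter> \<Gamma> (Inl A)))" using good[of "Inl A"] by (simp add: Good_def)
      show "spread (3 * \<Omega>) {B'. (A, B') \<in> K' \<and> A \<inter> B' = {}}"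
        by (rule spread_antimono[OF sp le_refl]) (use disj in \<open>force simp: \<Gamma>_def\<close>)
      have "K' \<inter> \<Gamma> (Inr B) \<noteq> {}" using AB by (auto simp: \<Gamma>_def)
      then have sp: "spread (3 * \<Omega>) (fst ` (K' \<inter> \<Gamma> (Inr B)))" using good[of "Inr B"] by (simp add: Good_def)
      show "spread (3 * \<Omega>) {A'. (A', B) \<in> K'}"
        by (rule spread_antimono[OF sp le_refl]) (auto simp: \<Gamma>_def)
    qed
    then show False using noemb[of K'] K' by (auto simp: K0_def)
  qed
  have "\<exists>Y. finite Y \<and> card Y \<le> 3 * \<Omega> \<and> (\<forall>p\<in>R (Inl A). snd p \<inter> Y \<noteq> {})" for A
    using R(2)[of "Inl A"] by (auto simp: Good_def elim!: not_spreadE intro: exI[of _ "{}"])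
  then obtain C1 where C1: "\<And>A. finite (C1 A) \<and> card (C1 A) \<le> 3 * \<Omega> \<and> (\<forall>p\<in>R (Inl A). snd p \<inter> C1 A \<noteq> {})"
    by metis
  have "\<exists>Y. finite Y \<and> card Y \<le> 3 * \<Omega> \<and> (\<forall>p\<in>R (Inr B). fst p \<inter> Y \<noteq> {})" for B
    using R(2)[of "Inr B"] by (auto simp: Good_def elim!: not_spreadE intro: exI[of _ "{}"])
  then obtain C2 where C2: "\<And>B. finite (C2 B) \<and> card (C2 B) \<le> 3 * \<Omega> \<and> (\<forall>p\<in>R (Inr B). fst p \<inter> C2 B \<noteq> {})"
    by metis
  have "C1 A \<inter> B \<noteq> {} \<or> C2 B \<inter> A \<noteq> {}" if "A \<union> B \<in> H" "A \<inter> B = {}" "card A = a" "card B = b" for A B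
  proof -
    have "(A, B) \<in> K0" using that by (simp add: K0_def)
    then obtain \<kappa> where \<kappa>: "(A, B) \<in> R \<kappa>" using K0 \<open>K' = {}\<close> by blast
    show ?thesis
    proof (cases \<kappa>)
      case (Inl A')
      then have "A' = A" using R(1)[of \<kappa>] \<kappa> by (auto simp: \<Gamma>_def)
      then have "snd (A, B) \<inter> C1 A \<noteq> {}" using C1[of A] \<kappa> Inl by blast
      then show ?thesis by auto
    next
      case (Inr B')
      then have "B' = B" using R(1)[of \<kappa>] \<kappa> by (auto simp: \<Gamma>_def)
      then have "fst (A, B) \<inter> C2 B \<noteq> {}" using C2[of B] \<kappa> Inr by blast
      then show ?thesis by auto
    qed
  qed
  then show ?thesis using C1 C2 by (intro exI[of _ C1] exI[of _ C2]) simp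
qed

text \<open>The summands bound the edges losing a pair to (i), those losing a pair to (iii), and the
  rest, to which \<open>generated_edge\<close> applies.\<close>

lemma card_le_of_no_emb:
  fixes X :: "'x set" and \<delta> :: real
  assumes us0: "0 < length us" and X: "finite X" and H: "\<And>e. e \<in> H \<Longrightarrow> e \<subseteq> X \<and> card e = a + b"
    and L: "3 * \<Omega> \<le> L" and d: "0 \<le> \<delta>"
    and noemb: "\<And>\<phi> c K. (\<And>A B. (A, B) \<in> K \<Longrightarrow> A \<union> B \<in> H) \<Longrightarrow> \<not> emb (\<lambda>A B x. (A, B) \<in> K) (length us) \<phi> c"
    and nostable: "\<And>K. K \<subseteq> {(e, c). e \<in> H \<and> c \<in> e} \<Longrightarrow> stable X K L \<delta> \<Longrightarrow> K = {}"
  shows "real (card H) \<le> (real t - 1) * real (card X choose (a + b - 1)) +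
    \<delta> * real (card X) ^ (a + b - 1) + real (card X ^ (a + b - 2) * (2 ^ (a + b) * ((a + b + 2) * L))\<^sup>2)"
proof -
  define K1 where "K1 = {(e, c). e \<in> H \<and> c \<in> e}"
  let ?d = "\<delta> * real (card X) ^ (b - 1)"
  have fH: "finite H" using H X by (intro finite_subset[of H "Pow X"]) auto
  have "K1 \<subseteq> Pow X \<times> X" using H by (auto simp: K1_def)
  then have fK1: "finite K1" using X finite_subset by blast
  obtain K' R where K': "K' \<subseteq> K1"
    and good0: "\<forall>\<kappa>. K' \<inter> key_group \<kappa> = {} \<or> key_good L ?d \<kappa> (K' \<inter> key_group \<kappa>)"
    and R0: "\<forall>\<kappa>. R \<kappa> \<subseteq> K1 \<inter> key_group \<kappa> \<and> (R \<kappa> = {} \<or> \<not> key_good L ?d \<kappa> (R \<kappa>))"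
    and K1: "K1 = K' \<union> (\<Union>\<kappa>. R \<kappa>)"
    using elimination[OF fK1, of key_group "key_good L ?d"] by (elim exE conjE)
  have good: "K' \<inter> key_group \<kappa> = {} \<or> key_good L ?d \<kappa> (K' \<inter> key_group \<kappa>)" for \<kappa>
    using good0 by (rule spec)
  have R: "R \<kappa> \<subseteq> K1 \<inter> key_group \<kappa>" "R \<kappa> = {} \<or> \<not> key_good L ?d \<kappa> (R \<kappa>)" for \<kappa>
    using R0[rule_format, of \<kappa>] by - (erule conjE, assumption)+
  have "stable X K' L \<delta>"
    by (rule stable_of_elimination[OF X H K'[unfolded K1_def] good]) auto
  then have "K' = {}" using nostable K' by (simp add: K1_def)
  have fR: "finite (R \<kappa>)" for \<kappa> using R(1)[of \<kappa>] fK1 finite_subset by blast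
  have HX: "e \<subseteq> X" if "e \<in> H" for e using H[OF that] by simp
  have "\<exists>C1 C2. (\<forall>S. finite (C1 S) \<and> card (C1 S) \<le> 3 * \<Omega> \<and> finite (C2 S) \<and> card (C2 S) \<le> 3 * \<Omega>) \<and>
    (\<forall>A B. A \<union> B \<in> H \<longrightarrow> A \<inter> B = {} \<longrightarrow> card A = a \<longrightarrow> card B = b \<longrightarrow> C1 A \<inter> B \<noteq> {} \<or> C2 B \<inter> A \<noteq> {})"
  proof (rule split_covers[OF us0 X HX])
    show "\<not> emb (\<lambda>A B x. (A, B) \<in> K) (length us) \<phi> c"
      if "\<And>A B. (A, B) \<in> K \<Longrightarrow> A \<union> B \<in> H" for \<phi> c K
      using that by (rule noemb)
  qed
  then obtain C1 C2 where C12':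
    "\<forall>S. finite (C1 S) \<and> card (C1 S) \<le> 3 * \<Omega> \<and> finite (C2 S) \<and> card (C2 S) \<le> 3 * \<Omega>"
    "\<forall>A B. A \<union> B \<in> H \<longrightarrow> A \<inter> B = {} \<longrightarrow> card A = a \<longrightarrow> card B = b \<longrightarrow> C1 A \<inter> B \<noteq> {} \<or> C2 B \<inter> A \<noteq> {}"
    by (elim exE conjE)
  note C12 = C12'[rule_format]
  have "\<exists>Y. finite Y \<and> card Y \<le> L \<and> (\<forall>p\<in>R (Kernel S c). (fst p - S) \<inter> Y \<noteq> {})" for S c
  proof (cases "R (Kernel S c) = {}")
    case False
    then have "\<not> spread L ((\<lambda>(e, c'). e - S) ` R (Kernel S c))" using R(2)[of "Kernel S c"] by simp
    then obtain Y where Y: "finite Y" "card Y \<le> L"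
      "\<And>Z. Z \<in> (\<lambda>(e, c'). e - S) ` R (Kernel S c) \<Longrightarrow> Z \<inter> Y \<noteq> {}" by (rule not_spreadE) blast
    have "(fst p - S) \<inter> Y \<noteq> {}" if "p \<in> R (Kernel S c)" for p
      by (rule Y(3)) (use that in \<open>auto simp: case_prod_unfold\<close>)
    then show ?thesis using Y(1,2) by blast
  qed (auto intro: exI[of _ "{}"])
  then obtain C3 where C3: "\<And>S c. finite (C3 S c) \<and> card (C3 S c) \<le> L \<and>
      (\<forall>p\<in>R (Kernel S c). (fst p - S) \<inter> C3 S c \<noteq> {})" by metis
  \<comment> \<open>One covering function collects the transversals of both eliminations. Those of
    (ii) also depend on the centre, one of fewer than \<open>a + b\<close> elements of
    \<open>S\<close>; hence the factor \<open>a + b + 2\<close>.\<close>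
  define C where "C S = C1 S \<union> C2 S \<union> (\<Union>c\<in>S. C3 S c)" for S
  have C: "finite (C S) \<and> card (C S) \<le> (a + b + 2) * L" if S: "finite S" "card S < a + b" for S
  proof -
    have "card (\<Union>c\<in>S. C3 S c) \<le> (a + b) * L" using C3 S by (intro card_UN_mult) auto
    moreover have "card (C S) \<le> card (C1 S) + card (C2 S) + card (\<Union>c\<in>S. C3 S c)"
      unfolding C_def by (meson add_right_mono card_Un_le le_trans)
    moreover have "card (C1 S) \<le> L" "card (C2 S) \<le> L" using C12(1)[of S] L by auto
    ultimately have "card (C S) \<le> (a + b + 2) * L" by (simp add: algebra_simps)
    moreover have "finite (C S)" using C12(1)[of S] C3 S(1) by (simp add: C_def)
    ultimately show ?thesis by simp
  qed
  let ?D = "{e. e \<subseteq> X \<and> card e = a + b \<and> (\<exists>x y S S'. x \<in> e \<and> y \<in> e \<and> x \<noteq> y \<and>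
      S \<subseteq> e - {x, y} \<and> S' \<subseteq> e - {y} \<and> x \<in> C S \<and> y \<in> C S')}"
  let ?IP = "{P. P \<subseteq> X \<and> card P = a + b - 1}" and ?IA = "{A. A \<subseteq> X \<and> card A = a}"
  let ?HP = "\<Union>P\<in>?IP. fst ` R (Codeg P)" and ?HA = "\<Union>A\<in>?IA. fst ` R (Dense A)"
  have "H \<subseteq> ?HP \<union> ?HA \<union> ?D"
  proof
    fix e assume e: "e \<in> H"
    note eX = H[OF e]
    have fe: "finite e" using eX X finite_subset by blast
    show "e \<in> ?HP \<union> ?HA \<union> ?D"
    proof (rule ccontr)
      assume n: "e \<notin> ?HP \<union> ?HA \<union> ?D"
      have "\<exists>S. c \<in> S \<and> S \<subset> e \<and> (card S = b \<or> card S = a + 1) \<and> C S \<inter> (e - S) \<noteq> {}" if c: "c \<in> e" for c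
      proof -
        have "(e, c) \<in> K1" using e c by (simp add: K1_def)
        then obtain \<kappa> where \<kappa>: "(e, c) \<in> R \<kappa>" using K1 \<open>K' = {}\<close> by blast
        then have g: "(e, c) \<in> key_group \<kappa>" using R(1) by blast
        show ?thesis
        proof (cases \<kappa>)
          case (Codeg P)
          then have "P = e - {c}" using g by simp
          then have "P \<in> ?IP" using eX c fe by auto
          moreover have "e \<in> fst ` R (Codeg P)" using \<kappa> Codeg by force
          ultimately have "e \<in> ?HP" by (rule UN_I)
          then show ?thesis using n by simp
        next
          case (Dense A)
          then have "A \<in> ?IA" using g eX by auto
          moreover have "e \<in> fst ` R (Dense A)" using \<kappa> Dense by force
          ultimately have "e \<in> ?HA" by (rule UN_I)
          then show ?thesis using n by simp
        next
          case (Kernel S c')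
          then have S: "c' = c" "c \<in> S" "S \<subset> e" "card S = b \<or> card S = a + 1" using g by auto
          have "(fst (e, c) - S) \<inter> C3 S c \<noteq> {}" using C3 \<kappa> Kernel S(1) by blast
          then have "C S \<inter> (e - S) \<noteq> {}" using S(2) by (auto simp: C_def)
          then show ?thesis using S by blast
        qed
      qed
      moreover have "C A \<inter> B \<noteq> {} \<or> C B \<inter> A \<noteq> {}"
        if "A \<union> B = e" "A \<inter> B = {}" "card A = a" "card B = b" for A B
        using C12(2)[of A B] that e by (auto simp: C_def)
      ultimately have "\<exists>x y S S'. x \<in> e \<and> y \<in> e \<and> x \<noteq> y \<and> S \<subseteq> e - {x, y} \<and> S' \<subseteq> e - {y} \<and> x \<in> C S \<and> y \<in> C S'"
        using generated_edge[OF _ ab, of e C] eX by blast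
      then have "e \<in> ?D" using eX by simp
      then show False using n by simp
    qed
  qed
  moreover have fIP: "finite ?IP" and fIA: "finite ?IA" and fD: "finite ?D" using X by auto
  ultimately have "card H \<le> card (?HP \<union> ?HA \<union> ?D)" using fR by (intro card_mono) auto
  also have "\<dots> \<le> card ?HP + card ?HA + card ?D" by (meson add_right_mono card_Un_le le_trans)
  finally have "real (card H) \<le> real (card ?HP) + real (card ?HA) + real (card ?D)" by linarith
  moreover have "real (card ?HP) \<le> (real t - 1) * real (card X choose (a + b - 1))"
  proof -
    have "card (fst ` R (Codeg P)) \<le> t - 1" for P
    proof -
      have "card (fst ` R (Codeg P)) \<le> card (R (Codeg P))" by (rule card_image_le[OF fR])
      also have "\<dots> \<le> t - 1" using R(2)[of "Codeg P"] by auto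
      finally show ?thesis .
    qed
    then have "card ?HP \<le> (card X choose (a + b - 1)) * (t - 1)"
      using n_subsets[OF X, of "a + b - 1"] by (intro card_UN_mult[OF fIP]) auto
    then have "real (card ?HP) \<le> real ((card X choose (a + b - 1)) * (t - 1))" by (simp only: of_nat_le_iff)
    then show ?thesis using t_pos by (simp add: of_nat_diff mult.commute)
  qed
  moreover have "real (card ?HA) \<le> \<delta> * real (card X) ^ (a + b - 1)"
  proof -
    have RA: "real (card (fst ` R (Dense A))) \<le> ?d" for A
    proof -
      have "card (fst ` R (Dense A)) \<le> card (R (Dense A))" by (rule card_image_le[OF fR])
      moreover have "real (card (R (Dense A))) \<le> ?d" using R(2)[of "Dense A"] d by auto
      ultimately show ?thesis by linarith
    qed
    have "card ?HA \<le> (\<Sum>A\<in>?IA. card (fst ` R (Dense A)))" by (rule card_UN_le[OF fIA])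
    then have "real (card ?HA) \<le> real (\<Sum>A\<in>?IA. card (fst ` R (Dense A)))" by (simp only: of_nat_le_iff)
    also have "\<dots> = (\<Sum>A\<in>?IA. real (card (fst ` R (Dense A))))" by (rule of_nat_sum)
    also have "\<dots> \<le> (\<Sum>A\<in>?IA. ?d)" by (intro sum_mono RA)
    also have "\<dots> = real (card ?IA) * ?d" by simp
    also have "\<dots> \<le> real (card X ^ a) * ?d"
    proof (rule mult_right_mono)
      show "real (card ?IA) \<le> real (card X ^ a)"
        unfolding of_nat_le_iff by (rule card_subsets_le_power[OF X])
    qed (use d in simp)
    also have "\<dots> = \<delta> * real (card X) ^ (a + (b - 1))" by (simp add: power_add)
    finally show ?thesis using ab by simp
  qed
  moreover have "card ?D \<le> card X ^ (a + b - 2) * (2 ^ (a + b) * ((a + b + 2) * L))\<^sup>2"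
    using card_generated_edges[OF X C, of "a + b"] ab by (simp add: power2_eq_square)
  then have "real (card ?D) \<le> real (card X ^ (a + b - 2) * (2 ^ (a + b) * ((a + b + 2) * L))\<^sup>2)"
    by (simp only: of_nat_le_iff)
  ultimately show ?thesis by linarith
qed

end

section \<open>The two bounds\<close>

context blowup_tree
begin

text \<open>Half of \<open>\<epsilon>\<close> pays for (iii), the other half for the term of order
  \<open>n ^ (r - 2)\<close>, which is absorbed once \<open>n \<ge> M / \<delta>\<close>.\<close>

lemma free_card_le:
  fixes \<epsilon> :: real
  assumes us0: "0 < length us" and NE: "\<And>u. u \<in> U \<Longrightarrow> N u = {v\<in>V. {u, v} \<in> E}" and "\<epsilon> > 0"
  shows "\<exists>n0. \<forall>(X :: 'x set) H. r_graph (a + b) X H \<longrightarrow> n0 \<le> card X \<longrightarrow> free_of H (blowup a b U V E) \<longrightarrow>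
    real (card H) \<le> (real t - 1) * real (card X choose (a + b - 1)) + \<epsilon> * real (card X) ^ (a + b - 1)"
proof -
  define \<delta> where "\<delta> = \<epsilon> / 2"
  have d: "\<delta> > 0" using \<open>\<epsilon> > 0\<close> by (simp add: \<delta>_def)
  obtain L0 n1 where emb: "\<And>(X :: 'x set) K. stable X K L0 \<delta> \<Longrightarrow> K \<noteq> {} \<Longrightarrow> n1 \<le> card X \<Longrightarrow>
    \<exists>\<phi> c. emb (centred K) (length us) \<phi> c" using stable_emb_aux[OF d us0 le_refl] by blast
  define L where "L = L0 + 3 * \<Omega>"
  define M where "M = (2 ^ (a + b) * ((a + b + 2) * L))\<^sup>2"
  obtain n2 :: nat where n2: "real M / \<delta> < real n2" using reals_Archimedean2 by blast
  show ?thesis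
  proof (rule exI[of _ "n1 + n2"], intro allI impI)
    fix X :: "'x set" and H
    assume G: "r_graph (a + b) X H" and n: "n1 + n2 \<le> card X" and free: "free_of H (blowup a b U V E)"
    have X: "finite X" and H: "\<And>e. e \<in> H \<Longrightarrow> e \<subseteq> X \<and> card e = a + b" using G by (auto simp: r_graph_def)
    let ?n = "real (card X)"
    have le: "real (card H) \<le> (real t - 1) * real (card X choose (a + b - 1)) +
      \<delta> * ?n ^ (a + b - 1) + real (card X ^ (a + b - 2) * M)"
      unfolding M_def
    proof (rule card_le_of_no_emb[OF us0 X H])
      show "3 * \<Omega> \<le> L" by (simp add: L_def)
      show "0 \<le> \<delta>" using d by simp
      show "\<not> emb (\<lambda>A B x. (A, B) \<in> K) (length us) \<phi> c"
        if K: "\<And>A B. (A, B) \<in> K \<Longrightarrow> A \<union> B \<in> H" for \<phi> c K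
      proof
        assume "emb (\<lambda>A B x. (A, B) \<in> K) (length us) \<phi> c"
        from emb_contains_copy[OF this K NE] show False using free by simp
      qed
      show "K = {}" if K: "K \<subseteq> {(e, c). e \<in> H \<and> c \<in> e}" and st: "stable X K L \<delta>" for K
      proof (rule ccontr)
        assume "K \<noteq> {}"
        have "stable X K L0 \<delta>" by (rule stable_antimono[OF st]) (simp add: L_def)
        then obtain \<phi> c where e: "emb (centred K) (length us) \<phi> c" using emb \<open>K \<noteq> {}\<close> n by fastforce
        have "A \<union> B \<in> H" if "centred K A B x" for A B x using that K by (auto simp: centred_def)
        from emb_contains_copy[OF e this NE] show False using free by simp
      qed
    qed
    have "real n2 \<le> ?n" using n by simp
    then have "real M / \<delta> \<le> ?n" using n2 by linarith
    then have M: "real M \<le> \<delta> * ?n" using d by (simp add: field_simps)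
    have "real (card X ^ (a + b - 2) * M) = ?n ^ (a + b - 2) * real M" by simp
    also have "\<dots> \<le> ?n ^ (a + b - 2) * (\<delta> * ?n)" by (intro mult_left_mono M) simp
    also have "\<dots> = \<delta> * ?n ^ Suc (a + b - 2)" by simp
    also have "Suc (a + b - 2) = a + b - 1" using ab by simp
    finally show "real (card H) \<le> (real t - 1) * real (card X choose (a + b - 1)) + \<epsilon> * ?n ^ (a + b - 1)"
      using le by (simp add: \<delta>_def)
  qed
qed

end

section \<open>The extremal construction\<close>

definition star_family :: "nat \<Rightarrow> nat \<Rightarrow> nat \<Rightarrow> nat set set" where
  "star_family r m n = {e. e \<subseteq> {..<n} \<and> card e = r \<and> card (e \<inter> {..<m}) = 1}"

lemma card_star_family:
  assumes "m \<le> n" "0 < r"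
  shows "m * ((n - m) choose (r - 1)) \<le> card (star_family r m n)"
proof -
  let ?P = "{P. P \<subseteq> {m..<n} \<and> card P = r - 1}"
  let ?f = "\<lambda>(x, P). insert x P"
  have fin: "finite P" if "P \<in> ?P" for P using that finite_subset[of P "{m..<n}"] by simp
  have ins: "insert x P \<inter> {..<m} = {x}" "insert x P \<inter> {m..<n} = P" if "x < m" "P \<subseteq> {m..<n}" for x P
    using that by auto
  have "inj_on ?f ({..<m} \<times> ?P)"
  proof (rule inj_onI)
    fix p q assume pq: "p \<in> {..<m} \<times> ?P" "q \<in> {..<m} \<times> ?P" "?f p = ?f q"
    obtain x P y Q where p: "p = (x, P)" "q = (y, Q)" by (cases p, cases q) auto
    have *: "x \<in> {..<m}" "P \<subseteq> {m..<n}" "y \<in> {..<m}" "Q \<subseteq> {m..<n}" "insert x P = insert y Q"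
      using pq p by auto
    have "{x} = {y}" using ins(1)[of x P] ins(1)[of y Q] * by simp
    moreover have "P = Q" using ins(2)[of x P] ins(2)[of y Q] * by simp
    ultimately show "p = q" using p by simp
  qed
  then have "card ({..<m} \<times> ?P) = card (?f ` ({..<m} \<times> ?P))" by (simp add: card_image)
  also have "\<dots> \<le> card (star_family r m n)"
  proof (rule card_mono)
    show "finite (star_family r m n)"
      by (rule finite_subset[of _ "Pow {..<n}"]) (auto simp: star_family_def)
    show "?f ` ({..<m} \<times> ?P) \<subseteq> star_family r m n"
    proof
      fix e assume "e \<in> ?f ` ({..<m} \<times> ?P)"
      then obtain x P where *: "e = insert x P" "x < m" "P \<in> ?P" by auto
      then have P: "P \<subseteq> {m..<n}" "card P = r - 1" "finite P" using fin by blast+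
      have "x \<notin> P" using P(1) *(2) by auto
      then have "card e = r" using * P assms(2) by simp
      moreover have "e \<subseteq> {..<n}" using P(1) * assms(1) by auto
      moreover have "e \<inter> {..<m} = {x}" using ins(1)[OF *(2) P(1)] * by simp
      ultimately show "e \<in> star_family r m n" by (simp add: star_family_def)
    qed
  qed
  finally show ?thesis by (simp add: card_cartesian_product n_subsets)
qed

text \<open>Every edge of a copy meets the \<open>m\<close> special vertices exactly once, so the blocks meeting them
  form one side of the bipartition of the connected graph \<open>E\<close>.\<close>

lemma star_family_free:
  assumes tree: "tree_graph (U \<union> V) E" and bip: "bipartition (U \<union> V) E U V"
    and card: "m < card U" "m < card V" and ab: "0 < a" "0 < b"
  shows "free_of (star_family r m n) (blowup a b U V E)"
proof
  assume "contains_copy (star_family r m n) (blowup a b U V E)"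
  then obtain \<phi> where inj: "inj_on \<phi> (\<Union>(blowup a b U V E))"
    and copy: "\<And>S. S \<in> blowup a b U V E \<Longrightarrow> \<phi> ` S \<in> star_family r m n"
    by (auto simp: contains_copy_def)
  have UV: "U \<inter> V = {}" and EUV: "\<And>e. e \<in> E \<Longrightarrow> \<exists>u\<in>U. \<exists>v\<in>V. e = {u, v}"
    using bip by (auto simp: bipartition_def)
  define B where "B x = {x} \<times> {..<if x \<in> U then a else b}" for x
  define T where "T x \<longleftrightarrow> \<phi> ` B x \<inter> {..<m} \<noteq> {}" for x
  have blk: "B u \<union> B v \<in> blowup a b U V E" if "u \<in> U" "v \<in> V" "{u, v} \<in> E" for u v
    using that UV by (force simp: blowup_def B_def)
  have opp: "T u \<noteq> T v" if uv: "u \<in> U" "v \<in> V" "{u, v} \<in> E" for u v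
  proof -
    have "card (\<phi> ` (B u \<union> B v) \<inter> {..<m}) = 1" using copy[OF blk[OF uv]] by (simp add: star_family_def)
    then obtain z where z: "\<phi> ` (B u \<union> B v) \<inter> {..<m} = {z}" by (auto simp: card_1_singleton_iff)
    have "inj_on \<phi> (B u \<union> B v)" using blk[OF uv] by (intro inj_on_subset[OF inj]) auto
    moreover have "B u \<inter> B v = {}" using uv UV by (auto simp: B_def)
    ultimately have d: "\<phi> ` B u \<inter> \<phi> ` B v = {}"
      by (metis inj_on_image_Int[of \<phi> "B u \<union> B v"] Un_upper1 Un_upper2 image_empty)
    have "(\<phi> ` B u \<inter> {..<m}) \<inter> (\<phi> ` B v \<inter> {..<m}) = {}" using d by auto
    moreover have "(\<phi> ` B u \<inter> {..<m}) \<union> (\<phi> ` B v \<inter> {..<m}) = {z}" using z by auto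
    ultimately show ?thesis unfolding T_def Un_singleton_iff by auto
  qed
  have "U \<noteq> {}" "V \<noteq> {}" using card by auto
  then obtain u0 v0 where uv0: "u0 \<in> U" "v0 \<in> V" by auto
  have reach: "(u0, x) \<in> {(p, q). {p, q} \<in> E}\<^sup>*" if "x \<in> U \<union> V" for x
    using tree that uv0 by (auto simp: tree_graph_def connected_graph_def)
  have side: "(x \<in> U \<and> T x = T u0) \<or> (x \<in> V \<and> T x \<noteq> T u0)" if "x \<in> U \<union> V" for x
    using reach[OF that]
  proof (induction rule: rtrancl_induct)
    case base
    then show ?case using uv0 by simp
  next
    case (step y z)
    then have "{y, z} \<in> E" by simp
    then obtain u v where uv: "u \<in> U" "v \<in> V" "{y, z} = {u, v}" using EUV by blast
    then have "{u, v} \<in> E" using \<open>{y, z} \<in> E\<close> by simp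
    then show ?case using uv step.IH opp[OF uv(1,2)] UV by (auto simp: doubleton_eq_iff)
  qed
  have edge: "\<exists>y. {x, y} \<in> E" if "x \<in> U \<union> V" for x
    using tree_neighbour[OF tree that, of u0] tree_neighbour[OF tree that, of v0] uv0 UV
    by (cases "x = u0") auto
  \<comment> \<open>Injectivity of \<open>\<phi>\<close> is known only on points covered by edges of
    the blowup; every block is covered because no vertex of the tree is isolated.\<close>
  have cov: "B x \<subseteq> \<Union>(blowup a b U V E)" if x: "x \<in> U \<union> V" for x
  proof -
    obtain y where y: "{x, y} \<in> E" using edge[OF x] by blast
    then obtain u v where uv: "u \<in> U" "v \<in> V" "{x, y} = {u, v}" using EUV by blast
    then have "B u \<union> B v \<in> blowup a b U V E" using blk y by simp
    moreover have "x = u \<or> x = v" using uv(3) by (auto simp: doubleton_eq_iff)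
    ultimately show ?thesis by auto
  qed
  \<comment> \<open>Different blocks meeting the special set use different special vertices, so
    there are at most \<open>m\<close> such blocks.\<close>
  have few: "card W \<le> m" if W: "W \<subseteq> U \<union> V" "\<And>x. x \<in> W \<Longrightarrow> T x" for W
  proof -
    have "\<exists>z. z \<in> \<phi> ` B x \<and> z < m" if "x \<in> W" for x using W(2)[OF that] by (auto simp: T_def)
    then obtain g where g: "\<And>x. x \<in> W \<Longrightarrow> g x \<in> \<phi> ` B x \<and> g x < m" by metis
    have "inj_on g W"
    proof (rule inj_onI)
      fix x y assume xy: "x \<in> W" "y \<in> W" "g x = g y"
      obtain p q where pq: "p \<in> B x" "q \<in> B y" "g x = \<phi> p" "g y = \<phi> q" using g xy by blast
      then have "p = q" using inj_onD[OF inj, of p q] cov[of x] cov[of y] xy W(1) by auto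
      then show "x = y" using pq by (auto simp: B_def)
    qed
    then have "card W \<le> card {..<m}" using g by (intro card_inj_on_le[of g]) auto
    then show ?thesis by simp
  qed
  show False
  proof (cases "T u0")
    case True
    then have "T x" if "x \<in> U" for x using side[of x] that UV by auto
    then show False using few[of U] card by auto
  next
    case False
    then have "T x" if "x \<in> V" for x using side[of x] that UV by auto
    then show False using few[of V] card by auto
  qed
qed

text \<open>By Pascal's rule each decrement of the upper index costs at most \<open>n ^ k\<close>.
  Taking away the \<open>t - 1\<close> special vertices thus changes the main term only by order
  \<open>n ^ (r - 2)\<close>.\<close>

lemma binomial_le_shift:
  assumes "m \<le> n"
  shows "n choose Suc k \<le> ((n - m) choose Suc k) + m * n ^ k"
  using assms
proof (induction m)
  case (Suc m)
  have "n - m = Suc (n - Suc m)" using Suc by simp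
  then have "(n - m) choose Suc k = ((n - Suc m) choose k) + ((n - Suc m) choose Suc k)" by simp
  moreover have "(n - Suc m) choose k \<le> (n - Suc m) ^ k"
    by (cases "k \<le> n - Suc m") (simp_all add: binomial_le_pow binomial_eq_0)
  moreover have "(n - Suc m) ^ k \<le> n ^ k" by (simp add: power_mono)
  ultimately show ?case using Suc by simp
qed simp

lemma turan_number_bounds:
  assumes "F \<noteq> {}" and "\<And>e. e \<in> F \<Longrightarrow> e \<noteq> {}"
  shows "\<exists>H. r_graph r {..<n} H \<and> free_of H F \<and> card H = turan_number r n F"
    and "r_graph r {..<n} H \<Longrightarrow> free_of H F \<Longrightarrow> card H \<le> turan_number r n F"
proof -
  let ?S = "{card H | H. r_graph r {..<n} H \<and> free_of H F}"
  have "?S \<subseteq> card ` Pow (Pow {..<n})" by (auto simp: r_graph_def)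
  then have fin: "finite ?S" by (rule finite_subset) simp
  have "free_of {} F" using assms by (auto simp: contains_copy_def)
  then have "card {} \<in> ?S" by (force simp: r_graph_def)
  then have "turan_number r n F \<in> ?S" unfolding turan_number_def by (intro Max_in fin) auto
  then show "\<exists>H. r_graph r {..<n} H \<and> free_of H F \<and> card H = turan_number r n F" by auto
  show "card H \<le> turan_number r n F" if "r_graph r {..<n} H" "free_of H F"
    unfolding turan_number_def using that by (intro Max_ge fin) auto
qed

theorem theorem2:
  fixes r s t a b :: nat
    and U V :: "'v set" and E :: "'v set set"
  assumes "r \<ge> 3" and "s \<ge> 2" and "t \<ge> 2"
    and "a + b = r" and "b < a" and "a < r"
    and "tree_graph (U \<union> V) E"
    and "bipartition (U \<union> V) E U V"
    and "card U = s" and "card V = t"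
  shows "(\<exists>h :: nat \<Rightarrow> real. h \<in> o(\<lambda>n. real n ^ (r - 1)) \<and>
            (\<forall>n (X :: 'x set) H.
               r_graph r X H \<and> card X = n \<and> free_of H (blowup a b U V E) \<longrightarrow>
               real (card H) \<le> (real t - 1) * real (n choose (r - 1)) + h n))
       \<and> (t \<le> s \<longrightarrow>
            (\<lambda>n. real (turan_number r n (blowup a b U V E))
                 - (real t - 1) * real (n choose (r - 1)))
              \<in> o(\<lambda>n. real n ^ (r - 1)))"
proof -
  note tree = assms(7) and bip = assms(8)
  let ?F = "blowup a b U V E"
  define N where "N u = {v\<in>V. {u, v} \<in> E}" for u
  have fin: "finite U" "finite V" and ne: "U \<noteq> {}" "V \<noteq> {}"
    using assms(2,3,9,10) by (auto intro: card_ge_0_finite)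
  have UV: "U \<inter> V = {}" and EUV: "\<And>e. e \<in> E \<Longrightarrow> \<exists>u\<in>U. \<exists>v\<in>V. e = {u, v}"
    using bip by (auto simp: bipartition_def)
  obtain us where us: "distinct us" "set us = U"
    "\<And>i. 0 < i \<Longrightarrow> i < length us \<Longrightarrow> \<exists>v. N (us ! i) \<inter> \<Union>(N ` set (take i us)) = {v}"
    using tree_order[OF tree bip fin(1) ne(1)] unfolding N_def by blast
  have cover: "\<Union>(N ` U) = V"
  proof (intro equalityI subsetI)
    fix v assume v: "v \<in> V"
    obtain u where "u \<in> U" using ne by auto
    then obtain z where z: "{v, z} \<in> E" using tree_neighbour[OF tree, of v u] v UV by auto
    then obtain u v' where "u \<in> U" "v' \<in> V" "{v, z} = {u, v'}" using EUV by blast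
    then have "u \<in> U" "{u, v} \<in> E" using v z UV by (auto simp: doubleton_eq_iff insert_commute)
    then show "v \<in> \<Union>(N ` U)" using v by (auto simp: N_def)
  qed (auto simp: N_def)
  interpret blowup_tree U V N us a b t
    by unfold_locales (use assms fin UV us cover in \<open>auto simp: N_def\<close>)
  have us0: "0 < length us" using us ne by auto
  \<comment> \<open>The vertex type is left open because the bound is used for \<open>'x\<close> in
    the first claim and for \<open>nat\<close> in the second.\<close>
  have upper: "\<exists>n0. \<forall>(X :: 'y set) H. r_graph r X H \<longrightarrow> n0 \<le> card X \<longrightarrow> free_of H ?F \<longrightarrow>
    real (card H) \<le> (real t - 1) * real (card X choose (r - 1)) + \<epsilon> * real (card X) ^ (r - 1)"
    if "\<epsilon> > 0" for \<epsilon>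
    using free_card_le[OF us0 N_def that] unfolding assms(4) .
  show ?thesis
  proof (intro conjI impI)
    define S where "S n = {real (card H) - (real t - 1) * real (n choose (r - 1)) | (X :: 'x set) H.
      r_graph r X H \<and> card X = n \<and> free_of H ?F}" for n
    \<comment> \<open>One error term has to serve all \<open>X\<close> and \<open>H\<close> on
      \<open>n\<close> vertices, hence the supremum; the inserted 0 keeps it meaningful if
      \<open>S n\<close> is empty and makes \<open>h\<close> nonnegative.\<close>
    define h where "h n = Sup (insert 0 (S n))" for n
    have bdd: "bdd_above (insert 0 (S n))" for n
    proof (rule bdd_aboveI[of _ "2 ^ n"])
      fix x assume "x \<in> insert 0 (S n)"
      then consider "x = 0" | X :: "'x set" and H where "r_graph r X H" "card X = n"
        "x = real (card H) - (real t - 1) * real (n choose (r - 1))" by (auto simp: S_def)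
      then show "x \<le> 2 ^ n"
      proof cases
        case 2
        then have "card H \<le> card (Pow X)" by (intro card_mono) (auto simp: r_graph_def)
        then have "card H \<le> 2 ^ n" using 2 by (simp add: card_Pow r_graph_def)
        then have "real (card H) \<le> 2 ^ n" by (metis of_nat_le_iff of_nat_numeral of_nat_power)
        moreover have "0 \<le> (real t - 1) * real (n choose (r - 1))" using assms(3) by simp
        ultimately show ?thesis using 2 by linarith
      qed simp
    qed
    have h0: "0 \<le> h n" for n unfolding h_def by (rule cSup_upper[OF _ bdd]) simp
    have "h \<in> o(\<lambda>n. real n ^ (r - 1))"
    proof (rule landau_o.smallI)
      fix c :: real assume "c > 0"
      from upper[OF this] obtain n0 where n0: "\<forall>(X :: 'x set) H. r_graph r X H \<longrightarrow> n0 \<le> card X \<longrightarrow>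
        free_of H ?F \<longrightarrow> real (card H) \<le> (real t - 1) * real (card X choose (r - 1)) +
        c * real (card X) ^ (r - 1)" by (elim exE)
      show "\<forall>\<^sub>F n in at_top. norm (h n) \<le> c * norm (real n ^ (r - 1))"
      proof (rule eventually_at_top_linorderI[of n0])
        fix n assume "n0 \<le> n"
        have "h n \<le> c * real n ^ (r - 1)"
          unfolding h_def
        proof (rule cSup_least)
          fix x assume "x \<in> insert 0 (S n)"
          then show "x \<le> c * real n ^ (r - 1)"
            using n0 \<open>n0 \<le> n\<close> \<open>c > 0\<close> by (fastforce simp: S_def)
        qed simp
        then show "norm (h n) \<le> c * norm (real n ^ (r - 1))" using h0[of n] by simp
      qed
    qed
    moreover have "real (card H) \<le> (real t - 1) * real (n choose (r - 1)) + h n"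
      if "r_graph r X H" "card X = n" "free_of H ?F" for n H and X :: "'x set"
    proof -
      have "real (card H) - (real t - 1) * real (n choose (r - 1)) \<in> S n"
        using that by (auto simp: S_def)
      then have "real (card H) - (real t - 1) * real (n choose (r - 1)) \<le> h n"
        unfolding h_def by (intro cSup_upper[OF _ bdd]) simp
      then show ?thesis by simp
    qed
    ultimately show "\<exists>h :: nat \<Rightarrow> real. h \<in> o(\<lambda>n. real n ^ (r - 1)) \<and>
        (\<forall>n (X :: 'x set) H. r_graph r X H \<and> card X = n \<and> free_of H ?F \<longrightarrow>
          real (card H) \<le> (real t - 1) * real (n choose (r - 1)) + h n)" by blast
  next
    assume "t \<le> s"
    obtain v where "v \<in> V" using ne by auto
    then obtain u where "u \<in> U" "{u, v} \<in> E" using cover by (auto simp: N_def)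
    then have "?F \<noteq> {}" using \<open>v \<in> V\<close> by (auto simp: blowup_def)
    moreover have "e \<noteq> {}" if "e \<in> ?F" for e using that assms(5) by (fastforce simp: blowup_def)
    ultimately have F: "?F \<noteq> {}" "\<And>e. e \<in> ?F \<Longrightarrow> e \<noteq> {}" by blast+
    \<comment> \<open>Because \<open>t \<le> s\<close>, the number \<open>t - 1\<close> of special
      vertices is below both \<open>card U\<close> and \<open>card V\<close>, so neither side of the
      tree fits into them.\<close>
    have lower: "(real t - 1) * real (n choose (r - 1)) - real ((t - 1) * (t - 1)) * real n ^ (r - 2)
        \<le> real (turan_number r n ?F)" if n: "t \<le> n" for n
    proof -
      have r1: "r - 1 = Suc (r - 2)" using assms(1) by simp
      have "r_graph r {..<n} (star_family r (t - 1) n)" by (auto simp: r_graph_def star_family_def)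
      moreover have "free_of (star_family r (t - 1) n) ?F"
        using assms \<open>t \<le> s\<close> ab by (intro star_family_free[OF tree bip]) auto
      ultimately have T: "card (star_family r (t - 1) n) \<le> turan_number r n ?F"
        by (intro turan_number_bounds(2) F)
      have "(t - 1) * (n choose (r - 1)) \<le> (t - 1) * (((n - (t - 1)) choose (r - 1)) + (t - 1) * n ^ (r - 2))"
        unfolding r1 using n by (intro mult_le_mono2 binomial_le_shift) simp
      also have "\<dots> = (t - 1) * ((n - (t - 1)) choose (r - 1)) + (t - 1) * (t - 1) * n ^ (r - 2)"
        by (simp add: algebra_simps)
      also have "(t - 1) * ((n - (t - 1)) choose (r - 1)) \<le> turan_number r n ?F"
        by (rule le_trans[OF card_star_family T]) (use n assms(1) in auto)
      finally have "real ((t - 1) * (n choose (r - 1))) \<le>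
          real (turan_number r n ?F + (t - 1) * (t - 1) * n ^ (r - 2))" by (simp only: of_nat_le_iff add_right_mono)
      then show ?thesis using t_pos by (simp add: of_nat_diff)
    qed
    show "(\<lambda>n. real (turan_number r n ?F) - (real t - 1) * real (n choose (r - 1))) \<in> o(\<lambda>n. real n ^ (r - 1))"
    proof (rule landau_o.smallI)
      fix c :: real assume c: "c > 0"
      from upper[OF this] obtain n0 where n0: "\<forall>(X :: nat set) H. r_graph r X H \<longrightarrow> n0 \<le> card X \<longrightarrow>
        free_of H ?F \<longrightarrow> real (card H) \<le> (real t - 1) * real (card X choose (r - 1)) +
        c * real (card X) ^ (r - 1)" by (elim exE)
      obtain n1 :: nat where n1: "real ((t - 1) * (t - 1)) / c < real n1" using reals_Archimedean2 by blast
      show "\<forall>\<^sub>F n in at_top. norm (real (turan_number r n ?F) - (real t - 1) * real (n choose (r - 1)))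
          \<le> c * norm (real n ^ (r - 1))"
      proof (rule eventually_at_top_linorderI[of "n0 + n1 + t"])
        fix n assume n: "n0 + n1 + t \<le> n"
        obtain H where H: "r_graph r {..<n} H" "free_of H ?F" "card H = turan_number r n ?F"
          using turan_number_bounds(1)[of ?F r n] F by blast
        have up: "real (turan_number r n ?F) \<le> (real t - 1) * real (n choose (r - 1)) + c * real n ^ (r - 1)"
          using n0[rule_format, OF H(1) _ H(2)] H(3) n by simp
        have "real n1 \<le> real n" using n by simp
        then have "real ((t - 1) * (t - 1)) / c \<le> real n" using n1 by linarith
        then have "real ((t - 1) * (t - 1)) \<le> c * real n" using c by (simp add: pos_divide_le_eq mult.commute)
        then have "real ((t - 1) * (t - 1)) * real n ^ (r - 2) \<le> c * real n * real n ^ (r - 2)"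
          by (rule mult_right_mono) simp
        also have "\<dots> = c * real n ^ Suc (r - 2)" by simp
        also have "Suc (r - 2) = r - 1" using assms(1) by simp
        finally have lo: "(real t - 1) * real (n choose (r - 1)) - c * real n ^ (r - 1) \<le> real (turan_number r n ?F)"
          using lower[of n] n by linarith
        show "norm (real (turan_number r n ?F) - (real t - 1) * real (n choose (r - 1)))
            \<le> c * norm (real n ^ (r - 1))" using up lo by (simp add: abs_le_iff)
      qed
    qed
  qed
qed

end
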